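(* For any functors $F,G:\mathbb{Z}\to\mathbf{set}$, $$d_{\mathrm{B}}\left(\mathrm{dgm}^{\mathbb{Z}}_{\mathbf{set}}(F),\mathrm{dgm}^{\mathbb{Z}}_{\mathbf{set}}(G)\right)\le d_{\mathrm{I}}^{\mathbf{set}}(F,G).$$
   Context: $\mathbf{set}$ is the category of finite sets, and $\mathbb{Z}$ is regarded as a category via its usual order. $\mathbf{Int}(\mathbb{Z})$ is the collection of nonempty convex subsets (finite or infinite) of $\mathbb{Z}$. Rank invariant and persistence diagram. For $F:\mathbb{Z}\to\mathbf{set}$ and $I\in\mathbf{Int}(\mathbb{Z})$, $\mathrm{rk}(F)(I)$ is the cardinality of the image of the canonical map $\varprojlim F|_I\to\varinjlim F|_I$ in $\mathbf{Set}$ (the composite $\varprojlim F|_I\to F_a\to\varinjlim F|_I$ for any $a\in I$; independent of $a$). Let $\mathrm{nbd}(I)$ be the set of integers $p\notin I$ with $p+1\in I$ or $p-1\in I$ (so $|\mathrm{nbd}(I)|\le2$). Then $\mathrm{dgm}^{\mathbb{Z}}_{\mathbf{set}}(F)(I)=\sum_{S\subset\mathrm{nbd}(I)}(-1)^{|S|}\,\mathrm{rk}(F)(I\cup S)\in\mathbb{Z}$. These values are nonnegative, and $\mathrm{dgm}^{\mathbb{Z}}_{\mathbf{set}}(F)$ is regarded as the multiset of intervals in which $I$ has multiplicity $\mathrm{dgm}^{\mathbb{Z}}_{\mathbf{set}}(F)(I)$. Interleaving distance. For $\varepsilon\in\mathbb{Z}_{\ge0}$, let $F(\varepsilon):\mathbb{Z}\to\mathbf{set}$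 be the shifted functor $F(\varepsilon)_a=F_{a+\varepsilon}$, with shifted structure maps (and similarly for natural transformations). $F,G$ are $\varepsilon$-interleaved if there are natural transformations $f:F\Rightarrow G(\varepsilon)$ and $g:G\Rightarrow F(\varepsilon)$ such that $g(\varepsilon)\circ f$ and $f(\varepsilon)\circ g$ are the natural transformations $F\Rightarrow F(2\varepsilon)$ and $G\Rightarrow G(2\varepsilon)$ given by the structure maps. $d_{\mathrm{I}}^{\mathbf{set}}(F,G)$ is the infimum of $\varepsilon\in\mathbb{Z}_{\ge0}$ such that $F,G$ are $\varepsilon$-interleaved ($\infty$ if none). Bottleneck distance. Let $\overline{\mathbf{U}}=\{(u_1,u_2)\in[-\infty,\infty]^2:u_1\le u_2\}$. For multisets $X_1,X_2$ of points of $\overline{\mathbf{U}}$, an $\varepsilon$-matching ($\varepsilon\in[0,\infty)$) is a partial injection $\alpha:X_1\nrightarrow X_2$ such that $\|\mathbf{u}-\alpha(\mathbf{u})\|_\infty\le\varepsilon$ for all $\mathbf{u}\in\mathrm{dom}(\alpha)$ (with the convention that equal infinite coordinates differ by $0$), and every unmatched point $(u_1,u_2)$ of $X_1$ or $X_2$ satisfies $u_2-u_1\le2\varepsilon$. $d_{\mathrm{B}}(X_1,X_2)$ is the infimum of $\varepsilon$ for which an $\varepsilon$-matching exists ($\infty$ if none). A multiset of intervals of $\mathbb{Z}$ is viewed as a multiset in $\overline{\mathbf{U}}$ by viewing an interval of $\mathbb{Z}$ with minimum $a$ (or $a=-\infty$) and maximum $b$ (or $b=\infty$) as the half-open interval $[a,b+1)$,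 i.e. as the point $(a,b+1)$. *)

theory Defs
  imports "HOL-Analysis.Analysis"
begin

text \<open>
  A functor from the ordered set of integers to finite sets. All values of one functor live in a
  common type, but two functors may use different types. Structure maps and components of natural
  transformations are only meaningful on the carriers.
\<close>

record 'a zdiagram =
  ob :: "int \<Rightarrow> 'a set"
  hom :: "int \<Rightarrow> int \<Rightarrow> 'a \<Rightarrow> 'a"

definition zfunctor :: "'a zdiagram \<Rightarrow> bool" where
  "zfunctor F \<longleftrightarrow>
     (\<forall>a. finite (ob F a)) \<and>
     (\<forall>a b. a \<le> b \<longrightarrow> hom F a b \<in> ob F a \<rightarrow> ob F b) \<and>
     (\<forall>a. \<forall>x\<in>ob F a. hom F a a x = x) \<and>
     (\<forall>a b c. a \<le> b \<longrightarrow> b \<le> c \<longrightarrow> (\<forall>x\<in>ob F a. hom F b c (hom F a b x) = hom F a c x))"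

definition int_intervals :: "int set set" where
  "int_intervals = {I. I \<noteq> {} \<and> (\<forall>a\<in>I. \<forall>b\<in>I. {a..b} \<subseteq> I)}"


section \<open>Rank invariant and persistence diagram\<close>

definition lim_on :: "'a zdiagram \<Rightarrow> int set \<Rightarrow> (int \<Rightarrow> 'a) set" where
  "lim_on F I = {s \<in> Pi\<^sub>E I (ob F). \<forall>a\<in>I. \<forall>b\<in>I. a \<le> b \<longrightarrow> hom F a b (s a) = s b}"

definition colim_gen :: "'a zdiagram \<Rightarrow> int set \<Rightarrow> int \<times> 'a \<Rightarrow> int \<times> 'a \<Rightarrow> bool" where
  "colim_gen F I u v \<longleftrightarrow>
     fst u \<in> I \<and> fst v \<in> I \<and> fst u \<le> fst v \<and> snd u \<in> ob F (fst u) \<and>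
     snd v = hom F (fst u) (fst v) (snd u)"

definition colim_rel :: "'a zdiagram \<Rightarrow> int set \<Rightarrow> ((int \<times> 'a) \<times> (int \<times> 'a)) set" where
  "colim_rel F I = {(u, v). equivclp (colim_gen F I) u v}"

definition colim_on :: "'a zdiagram \<Rightarrow> int set \<Rightarrow> (int \<times> 'a) set set" where
  "colim_on F I = Sigma I (ob F) // colim_rel F I"

text \<open>The composite of the projection to the value at \<open>a\<close> with the injection into the colimit.\<close>

definition lim_to_colim :: "'a zdiagram \<Rightarrow> int set \<Rightarrow> int \<Rightarrow> (int \<Rightarrow> 'a) \<Rightarrow> (int \<times> 'a) set" where
  "lim_to_colim F I a s = colim_rel F I `` {(a, s a)}"

text \<open>The choice of \<open>a\<close> is irrelevant, see \<open>rk_eq\<close> below.\<close>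

definition rk :: "'a zdiagram \<Rightarrow> int set \<Rightarrow> nat" where
  "rk F I = card (lim_to_colim F I (SOME a. a \<in> I) ` lim_on F I)"

definition nbd :: "int set \<Rightarrow> int set" where
  "nbd I = {p. p \<notin> I \<and> (p + 1 \<in> I \<or> p - 1 \<in> I)}"

definition dgm :: "'a zdiagram \<Rightarrow> int set \<Rightarrow> int" where
  "dgm F I = (\<Sum>S\<in>Pow (nbd I). (-1) ^ card S * int (rk F (I \<union> S)))"

lemma equiv_colim_rel: "equiv UNIV (colim_rel F I)"
  unfolding colim_rel_def
  by (intro equivI refl_onI symI transI) (simp_all, metis equivclp_sym, metis equivclp_trans)

lemma lim_to_colim_indep:
  assumes "s \<in> lim_on F I" "a \<in> I" "b \<in> I"
  shows "lim_to_colim F I a s = lim_to_colim F I b s"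
proof -
  have *: "lim_to_colim F I c s = lim_to_colim F I d s" if "c \<in> I" "d \<in> I" "c \<le> d" for c d
  proof -
    have "colim_gen F I (c, s c) (d, s d)"
      using assms(1) that by (auto simp: colim_gen_def lim_on_def)
    hence "((c, s c), (d, s d)) \<in> colim_rel F I"
      by (auto simp: colim_rel_def)
    thus ?thesis
      unfolding lim_to_colim_def by (rule equiv_class_eq[OF equiv_colim_rel])
  qed
  show ?thesis
    using *[OF assms(2,3)] *[OF assms(3,2)] by (metis linear)
qed

lemma lim_to_colim_in_colim:
  assumes "s \<in> lim_on F I" "a \<in> I"
  shows "lim_to_colim F I a s \<in> colim_on F I"
  using assms by (auto simp: lim_to_colim_def colim_on_def lim_on_def intro!: quotientI)

lemma rk_eq:
  assumes "a \<in> I"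
  shows "rk F I = card (lim_to_colim F I a ` lim_on F I)"
proof -
  have "(SOME a. a \<in> I) \<in> I" using assms by (rule someI)
  hence "lim_to_colim F I (SOME a. a \<in> I) ` lim_on F I = lim_to_colim F I a ` lim_on F I"
    using assms by (intro image_cong refl lim_to_colim_indep)
  thus ?thesis by (simp add: rk_def)
qed


section \<open>Interleaving distance\<close>

definition zshift :: "nat \<Rightarrow> 'a zdiagram \<Rightarrow> 'a zdiagram" where
  "zshift e F = \<lparr>ob = (\<lambda>a. ob F (a + int e)), hom = (\<lambda>a b. hom F (a + int e) (b + int e))\<rparr>"

definition nat_trans :: "'a zdiagram \<Rightarrow> 'b zdiagram \<Rightarrow> (int \<Rightarrow> 'a \<Rightarrow> 'b) \<Rightarrow> bool" where
  "nat_trans F G f \<longleftrightarrow>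
     (\<forall>a. f a \<in> ob F a \<rightarrow> ob G a) \<and>
     (\<forall>a b. a \<le> b \<longrightarrow> (\<forall>x\<in>ob F a. f b (hom F a b x) = hom G a b (f a x)))"

definition interleaved :: "nat \<Rightarrow> 'a zdiagram \<Rightarrow> 'b zdiagram \<Rightarrow> bool" where
  "interleaved e F G \<longleftrightarrow>
     (\<exists>f g. nat_trans F (zshift e G) f \<and> nat_trans G (zshift e F) g \<and>
        (\<forall>a. \<forall>x\<in>ob F a. g (a + int e) (f a x) = hom F a (a + 2 * int e) x) \<and>
        (\<forall>a. \<forall>y\<in>ob G a. f (a + int e) (g a y) = hom G a (a + 2 * int e) y))"

definition d_I :: "'a zdiagram \<Rightarrow> 'b zdiagram \<Rightarrow> ereal" where
  "d_I F G = Inf {ereal (real e) | e. interleaved e F G}"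


section \<open>Bottleneck distance\<close>

text \<open>
  The library has only finite multisets, so a multiset of points is a multiplicity function;
  \<open>(u, i)\<close> with \<open>i < X u\<close> is the \<open>i\<close>-th copy of \<open>u\<close> in \<open>X\<close>.
\<close>

definition Ubar :: "(ereal \<times> ereal) set" where
  "Ubar = {(u1, u2). u1 \<le> u2}"

definition copies :: "('p \<Rightarrow> nat) \<Rightarrow> ('p \<times> nat) set" where
  "copies X = {(u, i). i < X u}"

text \<open>The case distinction is needed because \<open>\<infinity> - \<infinity> = \<infinity>\<close> in \<^typ>\<open>ereal\<close>.\<close>

definition coord_dist :: "ereal \<Rightarrow> ereal \<Rightarrow> ereal" where
  "coord_dist x y = (if x = y then 0 else \<bar>x - y\<bar>)"

definition point_dist :: "ereal \<times> ereal \<Rightarrow> ereal \<times> ereal \<Rightarrow> ereal" where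
  "point_dist u v = max (coord_dist (fst u) (fst v)) (coord_dist (snd u) (snd v))"

text \<open>On \<^const>\<open>Ubar\<close>, \<open>coord_dist (fst u) (snd u)\<close> is \<open>snd u - fst u\<close>, subject to the same convention.\<close>

definition eps_matching ::
  "real \<Rightarrow> (ereal \<times> ereal \<Rightarrow> nat) \<Rightarrow> (ereal \<times> ereal \<Rightarrow> nat) \<Rightarrow>
     ((ereal \<times> ereal) \<times> nat \<rightharpoonup> (ereal \<times> ereal) \<times> nat) \<Rightarrow> bool" where
  "eps_matching \<epsilon> X Y \<alpha> \<longleftrightarrow>
     dom \<alpha> \<subseteq> copies X \<and> ran \<alpha> \<subseteq> copies Y \<and> inj_on \<alpha> (dom \<alpha>) \<and>
     (\<forall>u v. \<alpha> u = Some v \<longrightarrow> point_dist (fst u) (fst v) \<le> ereal \<epsilon>) \<and>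
     (\<forall>(u, i)\<in>(copies X - dom \<alpha>) \<union> (copies Y - ran \<alpha>).
        coord_dist (fst u) (snd u) \<le> ereal (2 * \<epsilon>))"

definition d_B :: "(ereal \<times> ereal \<Rightarrow> nat) \<Rightarrow> (ereal \<times> ereal \<Rightarrow> nat) \<Rightarrow> ereal" where
  "d_B X Y = Inf {ereal \<epsilon> | \<epsilon>. 0 \<le> \<epsilon> \<and> (\<exists>\<alpha>. eps_matching \<epsilon> X Y \<alpha>)}"

definition interval_point :: "int set \<Rightarrow> ereal \<times> ereal" where
  "interval_point I =
     (if bdd_below I then ereal (real_of_int (Inf I)) else -\<infinity>,
      if bdd_above I then ereal (real_of_int (Sup I + 1)) else \<infinity>)"

text \<open>
  The multiset of points obtained from a multiset of intervals: the push-forward of multiplicities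
  along \<^const>\<open>interval_point\<close>. At most one interval contributes to each sum by
  \<open>inj_on_interval_point\<close> below.
\<close>

definition interval_points :: "(int set \<Rightarrow> nat) \<Rightarrow> ereal \<times> ereal \<Rightarrow> nat" where
  "interval_points m u = (\<Sum>I\<in>{I \<in> int_intervals. interval_point I = u}. m I)"

text \<open>Truncation by \<^const>\<open>nat\<close> loses nothing, by \<open>dgm_nonneg\<close> below.\<close>

definition dgm_points :: "'a zdiagram \<Rightarrow> ereal \<times> ereal \<Rightarrow> nat" where
  "dgm_points F = interval_points (\<lambda>I. nat (dgm F I))"

lemma coord_dist_eq_diff:
  assumes "x \<le> y" "\<not> (x = y \<and> \<bar>x\<bar> = \<infinity>)"
  shows "coord_dist x y = y - x"
  using assms by (cases x; cases y) (simp_all add: coord_dist_def)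

lemma int_interval_Inf:
  fixes I :: "int set"
  assumes "I \<noteq> {}" "bdd_below I"
  shows "Inf I \<in> I"
proof -
  obtain c where c: "c < Inf I + 1" "c \<in> I"
    using cInf_lessD[of I "Inf I + 1"] assms by auto
  moreover have "Inf I \<le> c" using assms c by (intro cInf_lower) auto
  ultimately have "Inf I = c" by linarith
  thus ?thesis using c by simp
qed

lemma int_interval_Sup:
  fixes I :: "int set"
  assumes "I \<noteq> {}" "bdd_above I"
  shows "Sup I \<in> I"
proof -
  obtain c where c: "Sup I - 1 < c" "c \<in> I"
    using less_cSupD[of I "Sup I - 1"] assms by auto
  moreover have "c \<le> Sup I" using assms c by (intro cSup_upper) auto
  ultimately have "Sup I = c" by linarith
  thus ?thesis using c by simp
qed

lemma mem_int_interval_iff: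
  assumes "I \<in> int_intervals"
  shows "x \<in> I \<longleftrightarrow> fst (interval_point I) \<le> ereal (real_of_int x) \<and>
           ereal (real_of_int x) < snd (interval_point I)"
proof
  assume "x \<in> I"
  thus "fst (interval_point I) \<le> ereal (real_of_int x) \<and>
         ereal (real_of_int x) < snd (interval_point I)"
    using cInf_lower[of x I] cSup_upper[of x I] by (auto simp: interval_point_def)
next
  assume x: "fst (interval_point I) \<le> ereal (real_of_int x) \<and>
         ereal (real_of_int x) < snd (interval_point I)"
  have ne: "I \<noteq> {}" and conv: "\<And>a b. a \<in> I \<Longrightarrow> b \<in> I \<Longrightarrow> {a..b} \<subseteq> I"
    using assms by (auto simp: int_intervals_def)
  have "\<exists>a\<in>I. a \<le> x"
  proof (cases "bdd_below I")
    case True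
    thus ?thesis using x int_interval_Inf[OF ne True] by (auto simp: interval_point_def)
  next
    case False
    thus ?thesis unfolding bdd_below_def by (meson linear)
  qed
  moreover have "\<exists>b\<in>I. x \<le> b"
  proof (cases "bdd_above I")
    case True
    hence "real_of_int x < real_of_int (Sup I + 1)"
      using x by (simp add: interval_point_def)
    hence "x < Sup I + 1" by linarith
    thus ?thesis using int_interval_Sup[OF ne True] by force
  next
    case False
    thus ?thesis unfolding bdd_above_def by (meson linear)
  qed
  ultimately show "x \<in> I" using conv by force
qed

lemma inj_on_interval_point: "inj_on interval_point int_intervals"
  by (intro inj_onI set_eqI) (simp add: mem_int_interval_iff)

lemma interval_point_in_Ubar:
  assumes "I \<in> int_intervals"
  shows "interval_point I \<in> Ubar"
proof -
  obtain x where "x \<in> I" using assms by (auto simp: int_intervals_def)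
  thus ?thesis
    using mem_int_interval_iff[OF assms, of x]
    by (cases "interval_point I") (auto simp: Ubar_def)
qed

lemma interval_points_interval_point:
  assumes "I \<in> int_intervals"
  shows "interval_points m (interval_point I) = m I"
proof -
  have "{J \<in> int_intervals. interval_point J = interval_point I} = {I}"
    using assms inj_on_interval_point by (auto dest: inj_onD)
  thus ?thesis by (simp add: interval_points_def)
qed


section \<open>Nonnegativity of the persistence diagram\<close>

lemma colim_rel_iff:
  assumes F: "zfunctor F" and u: "fst u \<in> I" "snd u \<in> ob F (fst u)"
  shows "(u, v) \<in> colim_rel F I \<longleftrightarrow> fst v \<in> I \<and> snd v \<in> ob F (fst v) \<and>
     (\<exists>c\<in>I. fst u \<le> c \<and> fst v \<le> c \<and> hom F (fst u) c (snd u) = hom F (fst v) c (snd v))"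
    (is "_ \<longleftrightarrow> ?R v")
proof
  have ty: "\<And>a b x. a \<le> b \<Longrightarrow> x \<in> ob F a \<Longrightarrow> hom F a b x \<in> ob F b"
    and id: "\<And>a x. x \<in> ob F a \<Longrightarrow> hom F a a x = x"
    and co: "\<And>a b c x. a \<le> b \<Longrightarrow> b \<le> c \<Longrightarrow> x \<in> ob F a \<Longrightarrow> hom F b c (hom F a b x) = hom F a c x"
    using F by (auto simp: zfunctor_def Pi_iff)
  {
    assume "(u, v) \<in> colim_rel F I"
    hence "equivclp (colim_gen F I) u v" by (simp add: colim_rel_def)
    thus "?R v"
    proof (induction rule: equivclp_induct)
      case base
      show ?case using u by auto
    next
      case (step y z)
      then obtain c where y: "fst y \<in> I" "snd y \<in> ob F (fst y)"
        and c: "c \<in> I" "fst u \<le> c" "fst y \<le> c"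
          "hom F (fst u) c (snd u) = hom F (fst y) c (snd y)" by auto
      have z: "fst z \<in> I" "snd z \<in> ob F (fst z)"
        using step.hyps(2) y step.IH by (auto simp: colim_gen_def intro: ty)
      define d where "d = max c (fst z)"
      have d: "d \<in> I" "c \<le> d" "fst z \<le> d" using c(1) z(1) by (auto simp: d_def max_def)
      have "hom F (fst u) d (snd u) = hom F c d (hom F (fst u) c (snd u))"
        using co[of "fst u" c d "snd u"] c d u by simp
      also have "\<dots> = hom F (fst y) d (snd y)"
        using co[of "fst y" c d "snd y"] c d y by simp
      also have "\<dots> = hom F (fst z) d (snd z)"
        using step.hyps(2)
      proof
        assume g: "colim_gen F I y z"
        thus ?thesis using co[of "fst y" "fst z" d "snd y"] d by (simp add: colim_gen_def)
      next
        assume g: "colim_gen F I z y"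
        thus ?thesis using co[of "fst z" "fst y" d "snd z"] c d by (simp add: colim_gen_def)
      qed
      finally show ?case using z d c by (intro conjI bexI[of _ d]) auto
    qed
  }
  {
    assume "?R v"
    then obtain c where c: "fst v \<in> I" "snd v \<in> ob F (fst v)" "c \<in> I" "fst u \<le> c" "fst v \<le> c"
       "hom F (fst u) c (snd u) = hom F (fst v) c (snd v)" by auto
    have "colim_gen F I u (c, hom F (fst u) c (snd u))"
      "colim_gen F I v (c, hom F (fst u) c (snd u))"
      using c u by (auto simp: colim_gen_def)
    hence "equivclp (colim_gen F I) u v"
      by (meson equivclp_trans equivclp_sym r_into_equivclp)
    thus "(u, v) \<in> colim_rel F I"
      by (simp add: colim_rel_def)
  }
qed

text \<open>
  Fix \<open>a \<in> I\<close>. Adding a point on the left of \<open>I\<close> shrinks the set of values at \<open>a\<close> of sections, but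
  does not change which elements over \<open>a\<close> are identified in the colimit; adding a point on the
  right does the opposite.
\<close>

definition vals :: "'a zdiagram \<Rightarrow> int set \<Rightarrow> int \<Rightarrow> 'a set" where
  "vals F I a = (\<lambda>s. s a) ` lim_on F I"

definition ident :: "'a zdiagram \<Rightarrow> int set \<Rightarrow> int \<Rightarrow> ('a \<times> 'a) set" where
  "ident F I a = {(x, y). x \<in> ob F a \<and> y \<in> ob F a \<and> (\<exists>c\<in>I. a \<le> c \<and> hom F a c x = hom F a c y)}"

lemma vals_subset: "a \<in> I \<Longrightarrow> vals F I a \<subseteq> ob F a"
  by (auto simp: vals_def lim_on_def)

lemma equiv_ident:
  assumes F: "zfunctor F" and a: "a \<in> I"
  shows "equiv (ob F a) (ident F I a)"
proof -
  have eq: "(x, y) \<in> ident F I a \<longleftrightarrow> x \<in> ob F a \<and> y \<in> ob F a \<and> ((a, x), (a, y)) \<in> colim_rel F I" for x y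
    using colim_rel_iff[OF F, of "(a, x)" I "(a, y)"] a by (auto simp: ident_def)
  show ?thesis
  proof (rule equivI)
    show "ident F I a \<subseteq> ob F a \<times> ob F a" by (auto simp: ident_def)
    show "refl_on (ob F a) (ident F I a)"
      using a by (auto simp: refl_on_def ident_def)
    show "sym (ident F I a)"
      by (auto simp: sym_def ident_def)
    show "trans (ident F I a)"
      using equiv_colim_rel[of F I] by (intro transI) (auto simp: eq equiv_def dest: transD)
  qed
qed

lemma card_image_eqI:
  assumes eq: "\<And>x y. x \<in> A \<Longrightarrow> y \<in> A \<Longrightarrow> f x = f y \<longleftrightarrow> g x = g y"
  shows "card (f ` A) = card (g ` A)"
proof -
  define h where "h = (\<lambda>c. g (inv_into A f c))"
  have h: "h (f x) = g x" if "x \<in> A" for x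
  proof -
    have "inv_into A f (f x) \<in> A" "f (inv_into A f (f x)) = f x"
      using that by (auto intro: inv_into_into f_inv_into_f)
    thus ?thesis using eq that by (simp add: h_def)
  qed
  have "inj_on h (f ` A)" using h eq by (auto intro!: inj_onI)
  moreover have "h ` f ` A = g ` A" using h by (simp add: image_image)
  ultimately show ?thesis using card_image by fastforce
qed

lemma rk_eq_vals:
  assumes F: "zfunctor F" and a: "a \<in> I"
  shows "rk F I = card (vals F I a // ident F I a)"
proof -
  define cls where "cls = (\<lambda>x. colim_rel F I `` {(a, x)})"
  have cls: "cls x = cls y \<longleftrightarrow> ident F I a `` {x} = ident F I a `` {y}"
    if "x \<in> ob F a" "y \<in> ob F a" for x y
  proof -
    have "cls x = cls y \<longleftrightarrow> ((a, x), (a, y)) \<in> colim_rel F I"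
      unfolding cls_def by (rule eq_equiv_class_iff[OF equiv_colim_rel]) auto
    also have "\<dots> \<longleftrightarrow> (x, y) \<in> ident F I a"
      using colim_rel_iff[OF F, of "(a, x)" I "(a, y)"] a that by (auto simp: ident_def)
    also have "\<dots> \<longleftrightarrow> ident F I a `` {x} = ident F I a `` {y}"
      using that by (intro eq_equiv_class_iff[OF equiv_ident[OF F a], symmetric])
    finally show ?thesis .
  qed
  have "lim_to_colim F I a ` lim_on F I = cls ` vals F I a"
    by (auto simp: lim_to_colim_def cls_def vals_def)
  hence "rk F I = card (cls ` vals F I a)" using rk_eq[OF a, of F] by simp
  also have "\<dots> = card ((\<lambda>x. ident F I a `` {x}) ` vals F I a)"
    using cls vals_subset[OF a, of F] by (intro card_image_eqI) (simp add: subset_iff)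
  also have "(\<lambda>x. ident F I a `` {x}) ` vals F I a = vals F I a // ident F I a"
    by (auto simp: quotient_def)
  finally show ?thesis .
qed

lemma card_quotient_exchange:
  assumes r: "equiv U r" and r': "equiv U r'" and "r \<subseteq> r'" and "A \<subseteq> B" "B \<subseteq> U" "finite B"
  shows "card (A // r) + card (B // r') \<le> card (B // r) + card (A // r')"
proof -
  have cl: "r' `` (r `` {x}) = r' `` {x}" if "x \<in> U" for x
  proof
    show "r' `` (r `` {x}) \<subseteq> r' `` {x}"
      using \<open>r \<subseteq> r'\<close> equivE[OF r'] by (auto dest: transD)
    have "(x, x) \<in> r" using r that by (auto simp: equiv_def refl_on_def)
    thus "r' `` {x} \<subseteq> r' `` (r `` {x})" by auto
  qed
  have img: "C // r' = (\<lambda>c. r' `` c) ` (C // r)" if "C \<subseteq> U" for C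
  proof -
    have "(\<lambda>c. r' `` c) ` (C // r) = (\<lambda>x. r' `` (r `` {x})) ` C"
      by (auto simp: quotient_def)
    also have "\<dots> = (\<lambda>x. r' `` {x}) ` C"
      using cl that by (intro image_cong) auto
    finally show ?thesis by (auto simp: quotient_def)
  qed
  have fin: "finite (B // r)" "finite (B // r')"
    using \<open>finite B\<close> by (auto simp: quotient_def)
  have sub: "A // r \<subseteq> B // r" "A // r' \<subseteq> B // r'"
    using \<open>A \<subseteq> B\<close> by (auto simp: quotient_def)
  have "B // r' - A // r' \<subseteq> (\<lambda>c. r' `` c) ` (B // r - A // r)"
    using img[of B] img[of A] assms(4,5) by auto
  hence "card (B // r' - A // r') \<le> card (B // r - A // r)"
    using fin by (meson card_image_le card_mono finite_Diff finite_imageI le_trans)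
  moreover have "card (B // r' - A // r') = card (B // r') - card (A // r')"
    "card (B // r - A // r) = card (B // r) - card (A // r)"
    "card (A // r) \<le> card (B // r)"
    using fin sub by (auto intro: card_Diff_subset card_mono finite_subset)
  ultimately show ?thesis by linarith
qed

lemma vals_antimono:
  assumes "I \<subseteq> J" "a \<in> I"
  shows "vals F J a \<subseteq> vals F I a"
proof
  fix x assume "x \<in> vals F J a"
  then obtain s where s: "s \<in> lim_on F J" "x = s a" by (auto simp: vals_def)
  hence "restrict s I \<in> lim_on F I" using assms by (auto simp: lim_on_def subset_iff PiE_mem)
  thus "x \<in> vals F I a" using s assms by (auto simp: vals_def image_iff intro!: bexI[of _ "restrict s I"])
qed

lemma vals_insert_right:
  assumes F: "zfunctor F" and p: "p - 1 \<in> I" "\<And>c. c \<in> I \<Longrightarrow> c < p" and a: "a \<in> I"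
  shows "vals F (insert p I) a = vals F I a"
proof
  show "vals F (insert p I) a \<subseteq> vals F I a" using a by (intro vals_antimono) auto
  have ty: "\<And>a b x. a \<le> b \<Longrightarrow> x \<in> ob F a \<Longrightarrow> hom F a b x \<in> ob F b"
    and id: "\<And>a x. x \<in> ob F a \<Longrightarrow> hom F a a x = x"
    and co: "\<And>a b c x. a \<le> b \<Longrightarrow> b \<le> c \<Longrightarrow> x \<in> ob F a \<Longrightarrow> hom F b c (hom F a b x) = hom F a c x"
    using F by (auto simp: zfunctor_def Pi_iff)
  show "vals F I a \<subseteq> vals F (insert p I) a"
  proof
    fix x assume "x \<in> vals F I a"
    then obtain s where s: "s \<in> Pi\<^sub>E I (ob F)" "x = s a"
      and h: "\<And>b c. b \<in> I \<Longrightarrow> c \<in> I \<Longrightarrow> b \<le> c \<Longrightarrow> hom F b c (s b) = s c"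
      by (auto simp: vals_def lim_on_def)
    define y where "y = hom F (p - 1) p (s (p - 1))"
    have m: "\<And>b. b \<in> I \<Longrightarrow> s b \<in> ob F b" using s(1) by auto
    have y: "y \<in> ob F p" using ty m p(1) by (simp add: y_def)
    have yb: "hom F b p (s b) = y" if "b \<in> I" for b
      using co[of b "p - 1" p "s b"] h[of b "p - 1"] m[OF that] p(1) p(2)[OF that] that
      by (simp add: y_def)
    have "p \<notin> I" using p(2) by blast
    have "s(p := y) \<in> lim_on F (insert p I)"
      unfolding lim_on_def
    proof (intro CollectI conjI ballI impI)
      show "s(p := y) \<in> Pi\<^sub>E (insert p I) (ob F)" using s(1) y by (rule PiE_fun_upd[rotated])
    next
      fix b c assume "b \<in> insert p I" "c \<in> insert p I" "b \<le> c"
      thus "hom F b c ((s(p := y)) b) = (s(p := y)) c"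
        using h yb id[OF y] \<open>p \<notin> I\<close> p(2)[of c] by (cases "b = p"; cases "c = p") auto
    qed
    moreover have "(s(p := y)) a = x" using a \<open>p \<notin> I\<close> s(2) by auto
    ultimately show "x \<in> vals F (insert p I) a" unfolding vals_def by (metis image_eqI)
  qed
qed

lemma ident_mono: "I \<subseteq> J \<Longrightarrow> ident F I a \<subseteq> ident F J a"
  by (auto simp: ident_def)

lemma ident_insert_left: "p < a \<Longrightarrow> ident F (insert p I) a = ident F I a"
  by (auto simp: ident_def)

lemma dgm_nonneg:
  assumes F: "zfunctor F" and I: "I \<in> int_intervals"
  shows "dgm F I \<ge> 0"
proof -
  obtain a where a: "a \<in> I" using I by (auto simp: int_intervals_def)
  have conv: "d \<in> I" if "b \<in> I" "c \<in> I" "b \<le> d" "d \<le> c" for b c d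
  proof -
    have "{b..c} \<subseteq> I" using I that(1,2) by (simp add: int_intervals_def)
    thus ?thesis using that(3,4) by auto
  qed
  define L where "L = {p. p \<notin> I \<and> p + 1 \<in> I}"
  define R where "R = {p. p \<notin> I \<and> p - 1 \<in> I}"
  have nbd: "nbd I = L \<union> R" by (auto simp: nbd_def L_def R_def)
  have Lt: "p < c" if "p \<in> L" "c \<in> I" for p c
    using conv[of c "p + 1" p] that by (force simp: L_def)
  have Rt: "c < p" if "p \<in> R" "c \<in> I" for p c
    using conv[of "p - 1" c p] that by (force simp: R_def)
  have Ld: "L = {} \<or> (\<exists>p. L = {p})"
  proof -
    have "p = q" if "p \<in> L" "q \<in> L" for p q
      using Lt[of p "q + 1"] Lt[of q "p + 1"] that by (auto simp: L_def)
    thus ?thesis by blast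
  qed
  have Rd: "R = {} \<or> (\<exists>p. R = {p})"
  proof -
    have "p = q" if "p \<in> R" "q \<in> R" for p q
      using Rt[of p "q - 1"] Rt[of q "p - 1"] that by (auto simp: R_def)
    thus ?thesis by blast
  qed
  define V where "V = vals F I a"
  define E where "E = ident F I a"
  have fin: "finite V"
    using F vals_subset[OF a, of F] by (auto simp: zfunctor_def V_def intro: finite_subset)
  have V: "V \<subseteq> ob F a" using vals_subset[OF a] by (simp add: V_def)
  have E: "equiv (ob F a) E" using equiv_ident[OF F a] by (simp add: E_def)
  have rk0: "rk F I = card (V // E)" using rk_eq_vals[OF F a] by (simp add: V_def E_def)
  have left: "\<exists>V'. V' \<subseteq> V \<and> vals F (insert p I) a = V' \<and> rk F (insert p I) = card (V' // E)"
    if "p \<in> L" for p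
    using rk_eq_vals[OF F, of a "insert p I"] ident_insert_left[OF Lt[OF that a], of F I]
      vals_antimono[of I "insert p I" a F] a by (auto simp: V_def E_def)
  have right: "\<exists>E'. E \<subseteq> E' \<and> equiv (ob F a) E' \<and> ident F (insert q I) a = E' \<and>
      rk F (insert q I) = card (V // E')" if "q \<in> R" for q
    using rk_eq_vals[OF F, of a "insert q I"] vals_insert_right[OF F _ Rt[OF that] a] that
      ident_mono[of I "insert q I" F a] equiv_ident[OF F, of a "insert q I"] a
    by (auto simp: V_def E_def R_def)
  have both: "rk F (insert p (insert q I)) =
      card (vals F (insert p I) a // ident F (insert q I) a)" if "p \<in> L" "q \<in> R" for p q
  proof -
    have "c < q" if "c \<in> insert p I" for c
      using that Rt[OF \<open>q \<in> R\<close>] Lt[OF \<open>p \<in> L\<close> a] Rt[OF \<open>q \<in> R\<close> a] by auto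
    hence "vals F (insert q (insert p I)) a = vals F (insert p I) a"
      using that a by (intro vals_insert_right[OF F]) (auto simp: R_def)
    moreover have "ident F (insert p (insert q I)) a = ident F (insert q I) a"
      using Lt[OF \<open>p \<in> L\<close> a] by (rule ident_insert_left)
    ultimately show ?thesis
      using rk_eq_vals[OF F, of a "insert p (insert q I)"] a by (simp add: insert_commute)
  qed
  have quot_mono: "card (V' // E) \<le> card (V // E)" if "V' \<subseteq> V" for V'
    using that fin by (intro card_mono) (auto simp: quotient_def)
  consider (none) "L = {}" "R = {}" | (l) p where "L = {p}" "R = {}"
    | (r) q where "L = {}" "R = {q}" | (lr) p q where "L = {p}" "R = {q}"
    using Ld Rd by blast
  thus ?thesis
  proof cases
    case none
    thus ?thesis by (simp add: dgm_def nbd)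
  next
    case l
    have "dgm F I = int (rk F I) - int (rk F (insert p I))"
      using l by (simp add: dgm_def nbd Pow_insert)
    thus ?thesis using left[of p] quot_mono l rk0 by auto
  next
    case r
    have "dgm F I = int (rk F I) - int (rk F (insert q I))"
      using r by (simp add: dgm_def nbd Pow_insert)
    thus ?thesis
      using right[of q] card_quotient_exchange[OF E _ _ empty_subsetI V fin] r rk0 by auto
  next
    case lr
    have pq: "p \<noteq> q" using Lt[of p a] Rt[of q a] lr a by auto
    have "dgm F I = int (rk F I) - int (rk F (insert p I)) - int (rk F (insert q I)) +
        int (rk F (insert p (insert q I)))"
    proof -
      have "Pow (nbd I) = {{}, {p}, {q}, {p, q}}" using lr by (auto simp: nbd)
      thus ?thesis using pq by (auto simp: dgm_def insert_commute)
    qed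
    moreover obtain V' where V': "V' \<subseteq> V" "vals F (insert p I) a = V'" "rk F (insert p I) = card (V' // E)"
      using left[of p] lr by auto
    moreover obtain E' where E': "E \<subseteq> E'" "equiv (ob F a) E'" "ident F (insert q I) a = E'"
      "rk F (insert q I) = card (V // E')"
      using right[of q] lr by auto
    moreover have "rk F (insert p (insert q I)) = card (V' // E')"
      using both[of p q] lr V' E' by simp
    ultimately show ?thesis
      using card_quotient_exchange[OF E E'(2) E'(1) V'(1) V fin] rk0 by linarith
  qed
qed

end

theory Submission
  imports Defs
begin

text \<open>
  Let \<open>Q\<close> be the image of \<open>f : F \<Rightarrow> G(\<epsilon>)\<close>. If \<open>B \<subseteq> A\<close> are finite sets, then a map \<open>h\<close> satisfies
  \<open>|h A| - |h B| \<le> |A| - |B|\<close>. Applied to images of structure maps, this bounds the number of bars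
  of \<open>Q\<close> with given birth that are alive at \<open>t\<close> by the same number for \<open>F\<close>, and from below by the
  number for \<open>F\<close> at \<open>t + 2\<epsilon>\<close>, because \<open>F \<rightarrow> Q \<rightarrow> F(2\<epsilon>)\<close> is the structure map. Similarly, the number
  of bars of \<open>Q\<close> with given death that are alive at \<open>t\<close> lies between those for \<open>G\<close> at \<open>t - \<epsilon>\<close> and
  \<open>t + \<epsilon>\<close>. Hence, matching the \<open>i\<close>-th longest bars within every birth class (\<open>Q\<close> and \<open>F\<close>) and
  within every death class (\<open>Q\<close> and \<open>G(\<epsilon>)\<close>) embeds the bars of \<open>Q\<close> into those of \<open>F\<close> and of \<open>G\<close>, misses only
  bars of length at most \<open>2\<epsilon>\<close>, and the resulting partial bijection moves endpoints by at most \<open>\<epsilon>\<close>.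
\<close>

section \<open>Ranks of intervals as cardinalities of images\<close>

definition im :: "'a zdiagram \<Rightarrow> int \<Rightarrow> int \<Rightarrow> 'a set" where
  "im F a b = hom F a b ` ob F a"

lemma zfunctorD:
  assumes "zfunctor F"
  shows "finite (ob F a)"
    and "a \<le> b \<Longrightarrow> x \<in> ob F a \<Longrightarrow> hom F a b x \<in> ob F b"
    and "x \<in> ob F a \<Longrightarrow> hom F a a x = x"
    and "a \<le> b \<Longrightarrow> b \<le> c \<Longrightarrow> x \<in> ob F a \<Longrightarrow> hom F b c (hom F a b x) = hom F a c x"
  using assms by (auto simp: zfunctor_def Pi_iff)

lemma finite_im: "zfunctor F \<Longrightarrow> finite (im F a b)"
  by (simp add: im_def zfunctorD(1))

lemma im_subset_ob: "zfunctor F \<Longrightarrow> a \<le> b \<Longrightarrow> im F a b \<subseteq> ob F b"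
  by (auto simp: im_def zfunctorD(2))

lemma hom_image_im: "zfunctor F \<Longrightarrow> a \<le> b \<Longrightarrow> b \<le> c \<Longrightarrow> hom F b c ` im F a b = im F a c"
  by (auto simp: im_def image_image zfunctorD(4))

lemma im_mono: "zfunctor F \<Longrightarrow> a \<le> b \<Longrightarrow> b \<le> c \<Longrightarrow> im F a c \<subseteq> im F b c"
  using hom_image_im[of F a b c] im_subset_ob[of F a b] by (auto simp: im_def)

text \<open>The finite sets \<open>im F b a\<close> shrink as \<open>b\<close> decreases, so one of
  least cardinality is contained in all the others.\<close>

lemma im_stabilizes:
  assumes F: "zfunctor F" and "a \<in> I"
  obtains c where "c \<in> I" "c \<le> a"
    "\<And>b. b \<in> I \<Longrightarrow> b \<le> c \<Longrightarrow> im F b a = (\<Inter>b\<in>{b\<in>I. b \<le> a}. im F b a)"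
proof -
  obtain c where c: "c \<in> I \<and> c \<le> a"
      "\<And>b. b \<in> I \<and> b \<le> a \<Longrightarrow> card (im F c a) \<le> card (im F b a)"
    using ex_has_least_nat[of "\<lambda>c. c \<in> I \<and> c \<le> a" a "\<lambda>c. card (im F c a)"] \<open>a \<in> I\<close> by auto
  have eq: "im F b a = im F c a" if "b \<in> I" "b \<le> c" for b
    using c that by (intro card_seteq finite_im[OF F] im_mono[OF F]) auto
  have "im F c a \<subseteq> im F b a" if "b \<in> I" "b \<le> a" for b
  proof (cases "b \<le> c")
    case True
    thus ?thesis using eq that by blast
  next
    case False
    thus ?thesis using that by (intro im_mono[OF F]) auto
  qed
  hence "im F c a = (\<Inter>b\<in>{b\<in>I. b \<le> a}. im F b a)" using c(1) by blast
  thus thesis using c(1) eq that by metis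
qed

lemma int_intervals_convex:
  assumes "I \<in> int_intervals" "b \<in> I" "c \<in> I" "b \<le> d" "d \<le> c"
  shows "d \<in> I"
proof -
  have "{b..c} \<subseteq> I" using assms(1-3) by (simp add: int_intervals_def)
  thus ?thesis using assms(4,5) by auto
qed

lemma hom_section:
  assumes F: "zfunctor F" and I: "I \<in> int_intervals"
    and ob: "\<And>b. b \<in> I \<Longrightarrow> s b \<in> ob F b"
    and step: "\<And>b. b \<in> I \<Longrightarrow> b + 1 \<in> I \<Longrightarrow> hom F b (b + 1) (s b) = s (b + 1)"
    and bc: "b \<in> I" "c \<in> I" "b \<le> c"
  shows "hom F b c (s b) = s c"
proof -
  have conv: "d \<in> I" if "b \<le> d" "d \<le> c" for d
    using int_intervals_convex[OF I bc(1,2)] that .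
  have "d \<le> c \<longrightarrow> hom F b d (s b) = s d" if "b \<le> d" for d
    using that
  proof (induction d rule: int_ge_induct)
    case base
    show ?case using zfunctorD(3)[OF F] ob bc by simp
  next
    case (step d)
    show ?case
    proof
      assume d: "d + 1 \<le> c"
      have "hom F b (d + 1) (s b) = hom F d (d + 1) (hom F b d (s b))"
        using zfunctorD(4)[OF F, of b d "d + 1"] step.hyps ob bc by simp
      also have "\<dots> = s (d + 1)"
        using step assms(4)[of d] conv[of d] conv[of "d + 1"] d by simp
      finally show "hom F b (d + 1) (s b) = s (d + 1)" .
    qed
  qed
  thus ?thesis using bc by simp
qed

text \<open>
  Over an interval unbounded below this is a compactness argument: the stable images map onto each
  other, so an element of a stable image can be lifted backwards one step at a time.
\<close>

lemma vals_eq_Inter: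
  assumes F: "zfunctor F" and I: "I \<in> int_intervals" and a: "a \<in> I"
  shows "vals F I a = (\<Inter>c\<in>{c\<in>I. c \<le> a}. im F c a)"
proof
  show "vals F I a \<subseteq> (\<Inter>c\<in>{c\<in>I. c \<le> a}. im F c a)"
    using a by (auto simp: vals_def lim_on_def im_def image_iff) (metis PiE_mem)
next
  define V where "V b = (\<Inter>c\<in>{c\<in>I. c \<le> b}. im F c b)" for b
  have V_eq: "\<exists>c\<in>I. c \<le> b \<and> (\<forall>d\<in>I. d \<le> c \<longrightarrow> V b = im F d b)" if b: "b \<in> I" for b
    using im_stabilizes[OF F b] unfolding V_def by metis
  have lift: "\<exists>y\<in>V (b - 1). hom F (b - 1) b y = x" if b: "b \<in> I" "b - 1 \<in> I" "x \<in> V b" for b x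
  proof -
    obtain c where c: "c \<in> I" "c \<le> b" "\<And>d. d \<in> I \<Longrightarrow> d \<le> c \<Longrightarrow> V b = im F d b"
      using V_eq[OF b(1)] by blast
    obtain d where d: "d \<in> I" "d \<le> b - 1" "\<And>e. e \<in> I \<Longrightarrow> e \<le> d \<Longrightarrow> V (b - 1) = im F e (b - 1)"
      using V_eq[OF b(2)] by blast
    \<comment> \<open>From \<open>min c d\<close> on downwards both stable images are images of the
      same source, so the map from \<open>b - 1\<close> to \<open>b\<close> carries one onto the
      other.\<close>
    have e: "min c d \<in> I" using c d by (auto simp: min_def)
    have "V b = hom F (b - 1) b ` V (b - 1)"
      using hom_image_im[OF F, of "min c d" "b - 1" b] c(3)[OF e] d(2) d(3)[OF e] by simp
    thus ?thesis using b(3) by auto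
  qed
  have Vob: "V b \<subseteq> ob F b" if "b \<in> I" for b
    using that im_subset_ob[OF F, of b b] by (auto simp: V_def)
  show "(\<Inter>c\<in>{c\<in>I. c \<le> a}. im F c a) \<subseteq> vals F I a"
  proof
    fix x assume "x \<in> (\<Inter>c\<in>{c\<in>I. c \<le> a}. im F c a)"
    hence x: "x \<in> V a" by (simp add: V_def)
    have conv: "d \<in> I" if "b \<in> I" "c \<in> I" "b \<le> d" "d \<le> c" for b c d
      using int_intervals_convex[OF I that] .
    \<comment> \<open>\<open>t n\<close> is a lift of \<open>x\<close> to index
      \<open>a - int n\<close>. The guards are there because \<open>I\<close> may end at a finite
      distance below \<open>a\<close>; \<open>t\<close> is arbitrary beyond that.\<close>
    have "\<exists>t. \<forall>n. (a - int n \<in> I \<longrightarrow> t n \<in> V (a - int n) \<and> (n = 0 \<longrightarrow> t n = x)) \<and>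
        (a - int (Suc n) \<in> I \<longrightarrow> hom F (a - int (Suc n)) (a - int n) (t (Suc n)) = t n)"
    proof (rule dependent_nat_choice)
      show "\<exists>y. a - int 0 \<in> I \<longrightarrow> y \<in> V (a - int 0) \<and> (0 = (0::nat) \<longrightarrow> y = x)"
        using x by auto
    next
      fix y n
      assume y: "a - int n \<in> I \<longrightarrow> y \<in> V (a - int n) \<and> (n = 0 \<longrightarrow> y = x)"
      show "\<exists>z. (a - int (Suc n) \<in> I \<longrightarrow> z \<in> V (a - int (Suc n)) \<and> (Suc n = 0 \<longrightarrow> z = x)) \<and>
          (a - int (Suc n) \<in> I \<longrightarrow> hom F (a - int (Suc n)) (a - int n) z = y)"
      proof (cases "a - int (Suc n) \<in> I")
        case True
        hence "a - int n \<in> I" using conv[OF True a] by simp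
        thus ?thesis using lift[of "a - int n" y] True y by (auto simp: algebra_simps)
      qed simp
    qed
    then obtain t where t: "\<And>n. a - int n \<in> I \<Longrightarrow> t n \<in> V (a - int n)" "t 0 = x"
      "\<And>n. a - int (Suc n) \<in> I \<Longrightarrow> hom F (a - int (Suc n)) (a - int n) (t (Suc n)) = t n"
      using a by force
    \<comment> \<open>Lifts up to \<open>a\<close>, forward images of \<open>x\<close> after it; at
      \<open>a\<close> both give \<open>x\<close>.\<close>
    define s where "s b = (if b \<le> a then t (nat (a - b)) else hom F a b x)" for b
    have ob: "s b \<in> ob F b" if "b \<in> I" for b
      using t(1)[of "nat (a - b)"] Vob[OF that] that x Vob[OF a] zfunctorD(2)[OF F, of a b x]
      by (auto simp: s_def)
    have step: "hom F b (b + 1) (s b) = s (b + 1)" if b: "b \<in> I" "b + 1 \<in> I" for b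
    proof (cases "b < a")
      case True
      have "nat (a - b) = Suc (nat (a - (b + 1)))" using True by simp
      thus ?thesis using t(3)[of "nat (a - (b + 1))"] True b by (simp add: s_def)
    next
      case False
      have "hom F b (b + 1) (hom F a b x) = hom F a (b + 1) x"
        using False x Vob[OF a] zfunctorD(4)[OF F, of a b "b + 1" x] by auto
      moreover have "s b = hom F a b x"
        using False t(2) zfunctorD(3)[OF F] x Vob[OF a] by (auto simp: s_def)
      ultimately show ?thesis using False by (simp add: s_def)
    qed
    have "restrict s I \<in> lim_on F I"
      using ob hom_section[OF F I ob step] by (auto simp: lim_on_def)
    moreover have "restrict s I a = x" using a t(2) by (simp add: s_def)
    ultimately show "x \<in> vals F I a" unfolding vals_def by (metis image_eqI)
  qed
qed

lemma vals_stable: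
  assumes F: "zfunctor F" and I: "I \<in> int_intervals" and a: "a \<in> I"
  obtains c where "c \<in> I" "c \<le> a" "\<And>b. b \<in> I \<Longrightarrow> b \<le> c \<Longrightarrow> vals F I a = im F b a"
  using im_stabilizes[OF F a] that unfolding vals_eq_Inter[OF F I a] by metis

text \<open>The kernel relations of \<open>hom F a e\<close> grow with \<open>e\<close> inside a
  finite set, so one of greatest cardinality contains all identifications made in the
  colimit.\<close>

lemma ident_stable:
  assumes F: "zfunctor F" and a: "a \<in> I"
  obtains d where "d \<in> I" "a \<le> d"
    "\<And>e. e \<in> I \<Longrightarrow> d \<le> e \<Longrightarrow>
      ident F I a = {(x, y). x \<in> ob F a \<and> y \<in> ob F a \<and> hom F a e x = hom F a e y}"
proof -
  define K where "K e = {(x, y). x \<in> ob F a \<and> y \<in> ob F a \<and> hom F a e x = hom F a e y}" for e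
  have sub: "K e \<subseteq> ob F a \<times> ob F a" for e by (auto simp: K_def)
  have fin: "finite (ob F a \<times> ob F a)" using zfunctorD(1)[OF F] by simp
  have mono: "K d \<subseteq> K e" if "a \<le> d" "d \<le> e" for d e
    using that zfunctorD(4)[OF F, of a d e] by (auto simp: K_def) metis
  have "\<exists>d. (d \<in> I \<and> a \<le> d) \<and> (\<forall>e. e \<in> I \<and> a \<le> e \<longrightarrow> card (K e) \<le> card (K d))"
  proof (rule ex_has_greatest_nat[of _ a])
    show "a \<in> I \<and> a \<le> a" using a by simp
    show "\<forall>y. y \<in> I \<and> a \<le> y \<longrightarrow> card (K y) < Suc (card (ob F a \<times> ob F a))"
      using card_mono[OF fin sub] by (simp add: le_imp_less_Suc)
  qed
  then obtain d where d: "d \<in> I" "a \<le> d" "\<And>e. e \<in> I \<Longrightarrow> a \<le> e \<Longrightarrow> card (K e) \<le> card (K d)"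
    by blast
  have eq: "K e = K d" if "e \<in> I" "d \<le> e" for e
    using that d(2) d(3)[of e] finite_subset[OF sub fin]
    by (intro card_seteq[symmetric] mono) auto
  have "K c \<subseteq> K d" if "c \<in> I" "a \<le> c" for c
    using that mono[of c d] eq[of c] by (cases "c \<le> d") auto
  hence "ident F I a = K d" using d(1,2) by (fastforce simp: ident_def K_def)
  thus thesis using that d eq by (metis K_def)
qed

text \<open>The limit is detected far enough to the left and the colimit far enough to the right, so
  even an infinite interval has the rank of a single structure map. All later passages to infinite
  endpoints rest on this.\<close>

lemma rk_stable:
  assumes F: "zfunctor F" and I: "I \<in> int_intervals"
  obtains c d where "c \<in> I" "d \<in> I" "c \<le> d"
    "\<And>a b. a \<in> I \<Longrightarrow> b \<in> I \<Longrightarrow> a \<le> c \<Longrightarrow> d \<le> b \<Longrightarrow> rk F I = card (im F a b)"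
proof -
  obtain m where m: "m \<in> I" using I by (auto simp: int_intervals_def)
  obtain c where c: "c \<in> I" "c \<le> m" "\<And>b. b \<in> I \<Longrightarrow> b \<le> c \<Longrightarrow> vals F I m = im F b m"
    using vals_stable[OF F I m] by blast
  obtain d where d: "d \<in> I" "m \<le> d" "\<And>e. e \<in> I \<Longrightarrow> d \<le> e \<Longrightarrow>
      ident F I m = {(x, y). x \<in> ob F m \<and> y \<in> ob F m \<and> hom F m e x = hom F m e y}"
    using ident_stable[OF F m] by blast
  have "rk F I = card (im F a b)" if ab: "a \<in> I" "b \<in> I" "a \<le> c" "d \<le> b" for a b
  proof -
    have "rk F I = card ((\<lambda>x. ident F I m `` {x}) ` vals F I m)"
      unfolding rk_eq_vals[OF F m] by (auto simp: quotient_def intro!: arg_cong[where f = card])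
    also have "\<dots> = card (hom F m b ` vals F I m)"
    proof (rule card_image_eqI)
      fix x y assume "x \<in> vals F I m" "y \<in> vals F I m"
      hence xy: "x \<in> ob F m" "y \<in> ob F m" using vals_subset[OF m, of F] by auto
      have "ident F I m `` {x} = ident F I m `` {y} \<longleftrightarrow> (x, y) \<in> ident F I m"
        using xy by (rule eq_equiv_class_iff[OF equiv_ident[OF F m]])
      thus "ident F I m `` {x} = ident F I m `` {y} \<longleftrightarrow> hom F m b x = hom F m b y"
        using d(3)[OF ab(2,4)] xy by simp
    qed
    also have "hom F m b ` vals F I m = im F a b"
      using c(3)[OF ab(1,3)] hom_image_im[OF F, of a m b] ab c(2) d(2) by simp
    finally show ?thesis .
  qed
  thus thesis using c(1,2) d(1,2) that[of c d] by simp
qed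

lemma rk_atLeastAtMost:
  assumes F: "zfunctor F" and "a \<le> b"
  shows "rk F {a..b} = card (im F a b)"
proof -
  have "{a..b} \<in> int_intervals" using assms by (auto simp: int_intervals_def)
  from rk_stable[OF F this] show ?thesis using assms by (metis atLeastAtMost_iff order_refl)
qed

lemma eventually_rk_atLeast:
  assumes F: "zfunctor F"
  shows "\<forall>\<^sub>F d in at_top. rk F {a..} = card (im F a d)"
proof -
  have "{a..} \<in> int_intervals" by (auto simp: int_intervals_def)
  from rk_stable[OF F this] obtain c d where "a \<le> c" "a \<le> d"
    "\<And>b. a \<le> b \<Longrightarrow> d \<le> b \<Longrightarrow> rk F {a..} = card (im F a b)"
    by (metis atLeast_iff order_refl)
  thus ?thesis
    unfolding eventually_at_top_linorder by (intro exI[of _ d]) simp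
qed

lemma eventually_rk_atMost:
  assumes F: "zfunctor F"
  shows "\<forall>\<^sub>F c in at_bot. rk F {..b} = card (im F c b)"
proof -
  have "{..b} \<in> int_intervals" by (auto simp: int_intervals_def)
  from rk_stable[OF F this] obtain c d where "c \<le> b" "d \<le> b"
    "\<And>a. a \<le> b \<Longrightarrow> a \<le> c \<Longrightarrow> rk F {..b} = card (im F a b)"
    by (metis atMost_iff order_refl)
  thus ?thesis
    unfolding eventually_at_bot_linorder by (intro exI[of _ c]) simp
qed

lemma eventually_rk_UNIV:
  assumes F: "zfunctor F"
  shows "\<forall>\<^sub>F d in at_top. rk F UNIV = rk F {..d}"
    and "\<forall>\<^sub>F c in at_bot. rk F UNIV = rk F {c..}"
proof -
  have "UNIV \<in> int_intervals" by (auto simp: int_intervals_def)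
  from rk_stable[OF F this] obtain c d where
    cd: "\<And>a b. a \<le> c \<Longrightarrow> d \<le> b \<Longrightarrow> rk F UNIV = card (im F a b)" by (metis UNIV_I)
  have "rk F UNIV = rk F {..b}" if b: "d \<le> b" for b
  proof -
    \<comment> \<open>Far enough to the left, one \<open>a\<close> computes both the rank over
      \<open>UNIV\<close> and that over \<open>{..b}\<close>.\<close>
    obtain a where "a \<le> c" "rk F {..b} = card (im F a b)"
      using eventually_happens[OF eventually_conj[OF eventually_le_at_bot[of c] eventually_rk_atMost[OF F, of b]]]
      by auto
    thus ?thesis using cd[of a b] b by simp
  qed
  thus "\<forall>\<^sub>F d in at_top. rk F UNIV = rk F {..d}"
    unfolding eventually_at_top_linorder by blast
  have "rk F UNIV = rk F {a..}" if a: "a \<le> c" for a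
  proof -
    obtain b where "d \<le> b" "rk F {a..} = card (im F a b)"
      using eventually_happens[OF eventually_conj[OF eventually_ge_at_top[of d] eventually_rk_atLeast[OF F, of a]]]
      by auto
    thus ?thesis using cd[of a b] a by simp
  qed
  thus "\<forall>\<^sub>F c in at_bot. rk F UNIV = rk F {c..}"
    unfolding eventually_at_bot_linorder by blast
qed

section \<open>Exchange and monotonicity inequalities for images of structure maps\<close>

lemma card_image_exchange:
  assumes "finite A" "B \<subseteq> A"
  shows "card (h ` A) + card B \<le> card A + card (h ` B)"
proof -
  have "h ` A = h ` B \<union> h ` (A - B)" using assms by auto
  hence "card (h ` A) \<le> card (h ` B) + card (h ` (A - B))" by (simp add: card_Un_le)
  also have "\<dots> \<le> card (h ` B) + (card A - card B)"
    using assms card_image_le[of "A - B" h] card_Diff_subset[of B A] finite_subset[of B A] by simp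
  finally show ?thesis using assms card_mono[of A B] by linarith
qed

lemma card_im_exchange:
  assumes F: "zfunctor F" and "a \<le> b" "b \<le> c" "c \<le> d"
  shows "card (im F b d) + card (im F a c) \<le> card (im F b c) + card (im F a d)"
  using card_image_exchange[OF finite_im[OF F] im_mono[OF F, of a b c], of "hom F c d"] assms
    hom_image_im[OF F, of b c d] hom_image_im[OF F, of a c d] by simp

lemma card_im_mono:
  assumes F: "zfunctor F" and "a \<le> b" "b \<le> c" "c \<le> d"
  shows "card (im F a d) \<le> card (im F b c)"
proof -
  have "im F a d = hom F c d ` im F a c" using hom_image_im[OF F, of a c d] assms by simp
  hence "card (im F a d) \<le> card (im F a c)" using card_image_le[OF finite_im[OF F]] by simp
  also have "\<dots> \<le> card (im F b c)"
    using im_mono[OF F, of a b c] assms by (simp add: card_mono finite_im[OF F])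
  finally show ?thesis .
qed


section \<open>Slots of an antitone function\<close>

text \<open>
  An endpoint is \<open>None\<close> if it is infinite (\<open>-\<infinity>\<close> for births, \<open>\<infinity>\<close> for deaths). The reflection
  \<open>x \<mapsto> 1 - x\<close> turns ``birth at most \<open>b\<close>'' into ``\<open>-b\<close> is before the reflected birth'', so that
  births and deaths are treated alike.
\<close>

definition before :: "int \<Rightarrow> int option \<Rightarrow> bool" where
  "before t e = (case e of None \<Rightarrow> True | Some x \<Rightarrow> t < x)"

definition flip :: "int option \<Rightarrow> int option" where
  "flip = map_option (\<lambda>x. 1 - x)"

lemma before_simps [simp]: "before t None" "before t (Some x) \<longleftrightarrow> t < x"
  by (simp_all add: before_def)

lemma flip_simps [simp]: "flip None = None" "flip (Some x) = Some (1 - x)" "flip (flip u) = u"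
  by (cases u; simp add: flip_def)+

lemma flip_inject [simp]: "flip u = flip v \<longleftrightarrow> u = v"
  by (metis flip_simps(3))

text \<open>
  Read \<open>N t\<close> as the number of bars of some class that are alive at time \<open>t\<close>. If the bars are
  numbered from \<open>0\<close> such that longer bars come first, then bar \<open>i\<close> is alive at \<open>t\<close> iff \<open>i < N t\<close>. There are
  \<open>mult N e\<close> bars dying at \<open>e\<close>, numbered consecutively from \<open>base N e\<close>.
\<close>

definition mult :: "(int \<Rightarrow> nat) \<Rightarrow> int option \<Rightarrow> nat" where
  "mult N e = (case e of None \<Rightarrow> Inf (range N) | Some x \<Rightarrow> N (x - 1) - N x)"

definition base :: "(int \<Rightarrow> nat) \<Rightarrow> int option \<Rightarrow> nat" where
  "base N e = (case e of None \<Rightarrow> 0 | Some x \<Rightarrow> N x)"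

text \<open>For \<open>e = Some x\<close> the numbers \<open>base N e + j\<close> run from
  \<open>N x\<close> up to but excluding \<open>N (x - 1)\<close>, and \<open>N t\<close> is at
  least \<open>N (x - 1)\<close> or at most \<open>N x\<close> according to whether
  \<open>t < x\<close>. For \<open>None\<close> they lie below every value of
  \<open>N\<close>.\<close>

lemma before_iff_index_less:
  assumes N: "antimono N" and j: "j < mult N e"
  shows "before t e \<longleftrightarrow> base N e + j < N t"
proof (cases e)
  case None
  have "Inf (range N) \<le> N t" by (intro cInf_lower) auto
  thus ?thesis using j None by (simp add: mult_def base_def)
next
  case (Some x)
  have "N (x - 1) \<le> N t" if "t < x" using that by (intro antimonoD[OF N]) simp
  moreover have "N t \<le> N x" if "\<not> t < x" using that by (intro antimonoD[OF N]) simp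
  ultimately show ?thesis using j Some by (fastforce simp: mult_def base_def)
qed

text \<open>A number below all values of \<open>N\<close> belongs to a bar that never dies;
  otherwise the bar dies at the first time where \<open>N\<close> no longer exceeds
  \<open>i\<close>.\<close>

lemma ex_slot:
  assumes N: "antimono N" and i: "i < N t"
  obtains e j where "j < mult N e" "base N e + j = i"
proof (cases "\<forall>t. i < N t")
  case True
  have "Inf (range N) \<in> range N" by (intro Inf_nat_def1) auto
  hence "i < mult N None" using True by (auto simp: mult_def)
  thus thesis using that[of i None] by (simp add: base_def)
next
  case False
  then obtain s where s: "N s \<le> i" by (auto simp: not_less)
  \<comment> \<open>The argument is the maximum of \<open>s\<close> and \<open>t\<close>, written so
    that the least such time can be sought over natural offsets from \<open>t\<close>.\<close>
  have "N (t + int (nat (s - t))) \<le> i"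
    using antimonoD[OF N, of s "t + int (nat (s - t))"] s by linarith
  hence "\<exists>n. N (t + int n) \<le> i" by blast
  then obtain n where n: "N (t + int n) \<le> i" "\<And>m. m < n \<Longrightarrow> i < N (t + int m)"
    using exists_least_iff[of "\<lambda>n. N (t + int n) \<le> i"] by (auto simp: not_le)
  obtain m where m: "n = Suc m" using i n(1) by (cases n) auto
  hence "i < N (t + int n - 1)" using n(2)[of m] by simp
  hence "i - N (t + int n) < mult N (Some (t + int n))" using n(1) by (simp add: mult_def)
  thus thesis using n(1) by (intro that[of "i - N (t + int n)" "Some (t + int n)"]) (simp_all add: base_def)
qed

lemma endpoint_eqI:
  assumes "\<And>t. before t e \<longleftrightarrow> before t e'"
  shows "e = e'"
proof (cases e; cases e')
  fix x y assume "e = Some x" "e' = Some y"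
  thus ?thesis using assms[of "x - 1"] assms[of "y - 1"] by simp
qed (use assms in force)+

text \<open>The number of a bar decides when it is alive, and this determines its endpoint.
  Injectivity of the maps on bars below comes from here.\<close>

lemma slot_unique:
  assumes N: "antimono N" and "j < mult N e" "j' < mult N e'" "base N e + j = base N e' + j'"
  shows "e = e' \<and> j = j'"
proof -
  have "e = e'" using assms before_iff_index_less[OF N] by (intro endpoint_eqI) metis
  thus ?thesis using assms by simp
qed

lemma mult_None_eqI:
  assumes N: "antimono N" and ev: "\<forall>\<^sub>F t in at_top. N t = k"
  shows "mult N None = k"
proof -
  obtain s where s: "\<And>t. s \<le> t \<Longrightarrow> N t = k" using ev by (auto simp: eventually_at_top_linorder)
  have "k \<le> N t" for t using antimonoD[OF N, of t "max s t"] s[of "max s t"] by simp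
  hence "Inf (range N) = k" using s[of s] by (intro cInf_eq_minimum) auto
  thus ?thesis by (simp add: mult_def)
qed

text \<open>A bar of \<open>P\<close> goes to the bar of \<open>N\<close> with the same number;
  comparing counts then compares deaths. The second alternative in \<open>NP\<close> serves times
  where \<open>P\<close> is clamped and hence maximal: all its bars are alive there.\<close>

lemma slot_transfer:
  assumes P: "antimono P" and N: "antimono N"
    and PN: "\<And>t. P t \<le> N (t - k)"
    and NP: "\<And>t. N t \<le> P (t - l) \<or> (\<forall>s. P s \<le> P (t - l))"
    and j: "j < mult P v"
  shows "\<exists>w i. i < mult N w \<and> base N w + i = base P v + j \<and>
    (\<forall>t. before t v \<longrightarrow> before (t - k) w) \<and> (\<forall>t. before t w \<longrightarrow> before (t - l) v)"
proof -
  \<comment> \<open>Any time at which the bar is alive will do: \<open>0\<close> if it never dies,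
    else the last time before its death.\<close>
  obtain r where r: "base P v + j < P r"
    using before_iff_index_less[OF P j, of "case v of None \<Rightarrow> 0 | Some x \<Rightarrow> x - 1"]
    by (cases v) auto
  hence "base P v + j < N (r - k)" using PN[of r] by simp
  then obtain w i where w: "i < mult N w" "base N w + i = base P v + j" using ex_slot[OF N] by metis
  have "before (t - k) w" if "before t v" for t
    using that before_iff_index_less[OF P j, of t] before_iff_index_less[OF N w(1), of "t - k"] w(2) PN[of t]
    by simp
  moreover have "before (t - l) v" if "before t w" for t
  proof -
    have "base P v + j < N t" using that before_iff_index_less[OF N w(1), of t] w(2) by simp
    hence "base P v + j < P (t - l)" using NP[of t] r by (auto intro: less_le_trans)
    thus ?thesis using before_iff_index_less[OF P j] by simp
  qed
  ultimately show ?thesis using w by blast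
qed

text \<open>Used in contrapositive: a bar of \<open>N\<close> whose number does not occur in
  \<open>P\<close> is dead at every \<open>t\<close> with \<open>N t \<le> P s\<close>. This bounds
  the length of unmatched bars.\<close>

lemma slot_reached:
  assumes P: "antimono P" and N: "antimono N" and i: "i < mult N w"
    and "before t w" "N t \<le> P s"
  shows "\<exists>v j. j < mult P v \<and> base P v + j = base N w + i"
proof -
  have "base N w + i < P s" using assms before_iff_index_less[OF N i, of t] by simp
  thus ?thesis using ex_slot[OF P] by metis
qed


section \<open>Counting bars by birth and by death\<close>

text \<open>The second endpoint is exclusive, as in the points of a diagram. A death not after the
  birth gives the empty set, hence the conditions \<open>bar u v \<noteq> {}\<close> below.\<close>

fun bar :: "int option \<Rightarrow> int option \<Rightarrow> int set" where
  "bar None None = UNIV"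
| "bar None (Some e) = {..e - 1}"
| "bar (Some b) None = {b..}"
| "bar (Some b) (Some e) = {b..e - 1}"

definition lo :: "int option \<Rightarrow> ereal" where
  "lo u = (case u of None \<Rightarrow> -\<infinity> | Some b \<Rightarrow> ereal (real_of_int b))"

definition hi :: "int option \<Rightarrow> ereal" where
  "hi v = (case v of None \<Rightarrow> \<infinity> | Some e \<Rightarrow> ereal (real_of_int e))"

definition pt :: "int option \<Rightarrow> int option \<Rightarrow> ereal \<times> ereal" where
  "pt u v = (lo u, hi v)"

lemma pt_inject [simp]: "pt u v = pt u' v' \<longleftrightarrow> u = u' \<and> v = v'"
  by (auto simp: pt_def lo_def hi_def split: option.splits)

lemma interval_point_bar:
  assumes "bar u v \<noteq> {}"
  shows "interval_point (bar u v) = pt u v"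
proof -
  have [simp]: "\<not> bdd_below {..e}" "\<not> bdd_above {b..}" "\<not> bdd_below (UNIV :: int set)"
    "\<not> bdd_above (UNIV :: int set)" for b e :: int
  proof -
    have "\<exists>x\<le>e. x < m" for m by (rule exI[of _ "min e m - 1"]) arith
    thus "\<not> bdd_below {..e}" by (auto simp: bdd_below_def not_le)
    have "\<exists>x\<ge>b. m < x" for m by (rule exI[of _ "max b m + 1"]) arith
    thus "\<not> bdd_above {b..}" by (auto simp: bdd_above_def not_le)
    show "\<not> bdd_below (UNIV :: int set)" "\<not> bdd_above (UNIV :: int set)"
      by (auto simp: bdd_below_def bdd_above_def not_le intro: lt_ex gt_ex)
  qed
  show ?thesis
    using assms by (cases u; cases v) (auto simp: interval_point_def pt_def lo_def hi_def)
qed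

lemma bar_in_int_intervals: "bar u v \<noteq> {} \<Longrightarrow> bar u v \<in> int_intervals"
  by (cases u; cases v) (auto simp: int_intervals_def)

lemma int_intervals_eq_bar:
  assumes "I \<in> int_intervals"
  obtains u v where "I = bar u v"
proof
  show "I = bar (if bdd_below I then Some (Inf I) else None) (if bdd_above I then Some (Sup I + 1) else None)"
  proof (rule set_eqI)
    fix x
    show "x \<in> I \<longleftrightarrow> x \<in> bar (if bdd_below I then Some (Inf I) else None)
        (if bdd_above I then Some (Sup I + 1) else None)"
      unfolding mem_int_interval_iff[OF assms] by (auto simp: interval_point_def)
  qed
qed

lemma dgm_points_pt: "dgm_points F (pt u v) = (if bar u v = {} then 0 else nat (dgm F (bar u v)))"
proof (cases "bar u v = {}")
  case True
  have empty: "{I \<in> int_intervals. interval_point I = pt u v} = {}"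
  proof -
    have False if I: "I \<in> int_intervals" "interval_point I = pt u v" for I
    proof -
      obtain u' v' where I': "I = bar u' v'" using int_intervals_eq_bar[OF I(1)] .
      hence "bar u' v' \<noteq> {}" using I(1) by (auto simp: int_intervals_def)
      thus False using interval_point_bar I(2) I' True by fastforce
    qed
    thus ?thesis by blast
  qed
  show ?thesis using True unfolding dgm_points_def interval_points_def empty by simp
next
  case False
  thus ?thesis
    using interval_points_interval_point[OF bar_in_int_intervals[OF False]]
    by (simp add: dgm_points_def interval_point_bar)
qed

lemma dgm_points_pos:
  assumes "0 < dgm_points F p"
  obtains u v where "p = pt u v" "bar u v \<noteq> {}"
proof -
  obtain I where I: "I \<in> int_intervals" "interval_point I = p"
    using assms unfolding dgm_points_def interval_points_def by (metis (mono_tags, lifting) empty_Collect_eq less_irrefl sum.empty)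
  obtain u v where uv: "I = bar u v" using int_intervals_eq_bar[OF I(1)] .
  hence "bar u v \<noteq> {}" using I(1) by (auto simp: int_intervals_def)
  thus thesis using that interval_point_bar uv I(2) by auto
qed

section \<open>The alternating sum of ranks for the four shapes of intervals\<close>

lemma dgm_atLeastAtMost:
  assumes "a \<le> b"
  shows "dgm F {a..b} = int (rk F {a..b}) - int (rk F {a - 1..b}) - int (rk F {a..b + 1}) +
    int (rk F {a - 1..b + 1})"
proof -
  have nbd: "nbd {a..b} = {a - 1, b + 1}" using assms by (auto simp: nbd_def)
  have "Pow (nbd {a..b}) = {{}, {a - 1}, {b + 1}, {a - 1, b + 1}}" unfolding nbd by auto
  moreover have "{a..b} \<union> {a - 1} = {a - 1..b}" "{a..b} \<union> {b + 1} = {a..b + 1}"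
    "{a..b} \<union> {a - 1, b + 1} = {a - 1..b + 1}" using assms by auto
  ultimately show ?thesis using assms by (simp add: dgm_def del: Un_insert_right)
qed

lemma dgm_atLeast: "dgm F {a..} = int (rk F {a..}) - int (rk F {a - 1..})"
proof -
  have "nbd {a..} = {a - 1}" by (auto simp: nbd_def)
  moreover have "{a..} \<union> {a - 1} = {a - 1..}" by auto
  ultimately show ?thesis by (simp add: dgm_def Pow_insert del: Un_insert_right)
qed

lemma dgm_atMost: "dgm F {..b} = int (rk F {..b}) - int (rk F {..b + 1})"
proof -
  have "nbd {..b} = {b + 1}" by (auto simp: nbd_def)
  moreover have "{..b} \<union> {b + 1} = {..b + 1}" by auto
  ultimately show ?thesis by (simp add: dgm_def Pow_insert del: Un_insert_right)
qed

lemma dgm_UNIV: "dgm F UNIV = int (rk F UNIV)"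
  by (simp add: dgm_def nbd_def)

text \<open>
  \<open>births F u t\<close> counts the bars with birth \<open>u\<close> that contain \<open>t\<close>, and \<open>deaths F v t\<close> the bars
  with death \<open>v\<close> that contain \<open>-t\<close>. The clamping by \<^const>\<open>max\<close> and \<^const>\<open>min\<close> continues
  these functions constantly to all \<open>t\<close>, which creates no further slots.
\<close>

definition births :: "'a zdiagram \<Rightarrow> int option \<Rightarrow> int \<Rightarrow> nat" where
  "births F u t = (case u of None \<Rightarrow> rk F {..t}
     | Some b \<Rightarrow> rk F {b..max b t} - rk F {b - 1..max b t})"

definition deaths :: "'a zdiagram \<Rightarrow> int option \<Rightarrow> int \<Rightarrow> nat" where
  "deaths F v t = (case v of None \<Rightarrow> rk F {- t..}
     | Some e \<Rightarrow> rk F {min (- t) (e - 1)..e - 1} - rk F {min (- t) (e - 1)..e})"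

lemma rk_exchange:
  assumes F: "zfunctor F" and "a \<le> b" "b \<le> c" "c \<le> d"
  shows "rk F {b..d} + rk F {a..c} \<le> rk F {b..c} + rk F {a..d}"
  using card_im_exchange[OF assms] assms(2-4) by (simp add: rk_atLeastAtMost[OF F])

lemma rk_mono:
  assumes F: "zfunctor F" and "a \<le> b" "b \<le> c" "c \<le> d"
  shows "rk F {a..d} \<le> rk F {b..c}"
  using card_im_mono[OF assms] assms(2-4) by (simp add: rk_atLeastAtMost[OF F])

lemma rk_atLeast_le:
  assumes F: "zfunctor F" and "a \<le> d"
  shows "rk F {a..} \<le> rk F {a..d}"
proof -
  obtain e where "d \<le> e" "rk F {a..} = card (im F a e)"
    using eventually_happens[OF eventually_conj[OF eventually_ge_at_top[of d] eventually_rk_atLeast[OF F, of a]]]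
    by auto
  thus ?thesis using rk_mono[OF F, of a a d e] assms by (simp add: rk_atLeastAtMost[OF F])
qed

text \<open>For infinite birth, both ranks are computed from a common source far to the left. For
  finite birth, \<open>rk_exchange\<close> gives the decrease and \<open>rk_mono\<close> excludes
  truncated subtraction at \<open>s\<close>.\<close>

lemma antimono_births:
  assumes F: "zfunctor F"
  shows "antimono (births F u)"
proof (rule antimonoI)
  fix s t :: int assume st: "s \<le> t"
  show "births F u t \<le> births F u s"
  proof (cases u)
    case None
    obtain c where "c \<le> s" "rk F {..s} = card (im F c s)" "rk F {..t} = card (im F c t)"
      using eventually_happens[OF eventually_conj[OF eventually_le_at_bot[of s]
          eventually_conj[OF eventually_rk_atMost[OF F, of s] eventually_rk_atMost[OF F, of t]]]] by auto
    thus ?thesis using None st card_im_mono[OF F, of c c s t] by (simp add: births_def)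
  next
    case (Some b)
    have "b \<le> max b s" "max b s \<le> max b t" using st by auto
    thus ?thesis
      using Some rk_exchange[OF F, of "b - 1" b "max b s" "max b t"]
        rk_mono[OF F, of "b - 1" b "max b s" "max b s"] unfolding births_def Some option.case by linarith
  qed
qed

lemma antimono_deaths:
  assumes F: "zfunctor F"
  shows "antimono (deaths F v)"
proof (rule antimonoI)
  fix s t :: int assume st: "s \<le> t"
  show "deaths F v t \<le> deaths F v s"
  proof (cases v)
    case None
    obtain d where "- s \<le> d" "rk F {- s..} = card (im F (- s) d)" "rk F {- t..} = card (im F (- t) d)"
      using eventually_happens[OF eventually_conj[OF eventually_ge_at_top[of "- s"]
          eventually_conj[OF eventually_rk_atLeast[OF F, of "- s"] eventually_rk_atLeast[OF F, of "- t"]]]] by auto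
    thus ?thesis using None st card_im_mono[OF F, of "- t" "- s" d d] by (simp add: deaths_def)
  next
    case (Some e)
    have "min (- t) (e - 1) \<le> min (- s) (e - 1)" "min (- s) (e - 1) \<le> e - 1" using st by auto
    thus ?thesis
      using Some rk_exchange[OF F, of "min (- t) (e - 1)" "min (- s) (e - 1)" "e - 1" e]
        rk_mono[OF F, of "min (- s) (e - 1)" "min (- s) (e - 1)" "e - 1" e]
      unfolding deaths_def Some option.case by linarith
  qed
qed

text \<open>For a finite death \<open>e\<close>, the alternating sum of ranks is the drop of
  \<open>births F u\<close> from \<open>e - 1\<close> to \<open>e\<close>; for an infinite one, it
  is the eventual value.\<close>

lemma dgm_points_births:
  assumes F: "zfunctor F"
  shows "dgm_points F (pt u v) = mult (births F u) v"
proof (cases v)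
  case None
  have "mult (births F u) None = nat (dgm F (bar u None))"
  proof (rule mult_None_eqI[OF antimono_births[OF F]])
    show "\<forall>\<^sub>F t in at_top. births F u t = nat (dgm F (bar u None))"
    proof (cases u)
      case None
      thus ?thesis
        using eventually_rk_UNIV(1)[OF F] by (auto simp: births_def dgm_UNIV elim: eventually_mono)
    next
      case (Some b)
      have "\<forall>\<^sub>F t in at_top. b \<le> t \<and> rk F {b..} = card (im F b t) \<and>
          rk F {b - 1..} = card (im F (b - 1) t)"
        by (intro eventually_conj eventually_ge_at_top eventually_rk_atLeast[OF F])
      thus ?thesis
        using Some
        by (auto simp: births_def dgm_atLeast rk_atLeastAtMost[OF F] max_def elim!: eventually_mono)
    qed
  qed
  thus ?thesis using None by (cases u) (simp_all add: dgm_points_pt)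
next
  case (Some e)
  show ?thesis
  proof (cases u)
    case None
    thus ?thesis using Some by (simp add: dgm_points_pt mult_def births_def dgm_atMost nat_diff_distrib')
  next
    case (Some b)
    show ?thesis
    proof (cases "b < e")
      case True
      thus ?thesis
        using Some \<open>v = Some e\<close> dgm_atLeastAtMost[of b "e - 1" F] rk_exchange[OF F, of "b - 1" b "e - 1" e]
          rk_mono[OF F, of "b - 1" b "e - 1" "e - 1"] rk_mono[OF F, of "b - 1" b e e]
        by (simp add: dgm_points_pt mult_def births_def)
    \<comment> \<open>If \<open>e \<le> b\<close>, both counts are clamped to \<open>b\<close>, so
      the slot is empty, like the bar.\<close>
    qed (use Some \<open>v = Some e\<close> in \<open>simp add: dgm_points_pt mult_def births_def\<close>)
  qed
qed

text \<open>Time is reflected: outside the clamped range, \<open>deaths F v (- b)\<close> counts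
  bars containing \<open>b\<close> and \<open>deaths F v (1 - b)\<close> those containing
  \<open>b - 1\<close>. Hence bars born at \<open>b\<close> make the drop at
  \<open>1 - b\<close>.\<close>

lemma dgm_points_deaths:
  assumes F: "zfunctor F"
  shows "dgm_points F (pt u v) = mult (deaths F v) (flip u)"
proof (cases u)
  case None
  have "mult (deaths F v) None = nat (dgm F (bar None v))"
  proof (rule mult_None_eqI[OF antimono_deaths[OF F]])
    have *: "(\<forall>\<^sub>F t in at_top. P (- t)) \<longleftrightarrow> eventually P (at_bot :: int filter)" for P
      unfolding at_bot_mirror eventually_filtermap ..
    show "\<forall>\<^sub>F t in at_top. deaths F v t = nat (dgm F (bar None v))"
    proof (cases v)
      case None
      have "\<forall>\<^sub>F t in at_top. rk F UNIV = rk F {- t..}"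
        using eventually_rk_UNIV(2)[OF F] by (subst *)
      thus ?thesis using None by (auto simp: deaths_def dgm_UNIV elim: eventually_mono)
    next
      case (Some e)
      have "\<forall>\<^sub>F t in at_bot. t \<le> e - 1 \<and> rk F {..e - 1} = card (im F t (e - 1)) \<and>
          rk F {..e} = card (im F t e)"
        by (intro eventually_conj eventually_le_at_bot eventually_rk_atMost[OF F])
      hence "\<forall>\<^sub>F t in at_top. - t \<le> e - 1 \<and> rk F {..e - 1} = card (im F (- t) (e - 1)) \<and>
          rk F {..e} = card (im F (- t) e)" by (subst *)
      thus ?thesis
        using Some
        by (auto simp: deaths_def dgm_atMost rk_atLeastAtMost[OF F] min_def elim!: eventually_mono)
    qed
  qed
  thus ?thesis using None by (cases v) (simp_all add: dgm_points_pt)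
next
  case (Some b)
  show ?thesis
  proof (cases v)
    case None
    thus ?thesis using Some by (simp add: dgm_points_pt mult_def deaths_def dgm_atLeast nat_diff_distrib')
  next
    case (Some e)
    show ?thesis
    proof (cases "b < e")
      case True
      thus ?thesis
        using Some \<open>u = Some b\<close> dgm_atLeastAtMost[of b "e - 1" F] rk_exchange[OF F, of "b - 1" b "e - 1" e]
          rk_mono[OF F, of "b - 1" "b - 1" "e - 1" e] rk_mono[OF F, of b b "e - 1" e]
        by (simp add: dgm_points_pt mult_def deaths_def)
    qed (use Some \<open>u = Some b\<close> in \<open>simp add: dgm_points_pt mult_def deaths_def\<close>)
  qed
qed

text \<open>\<open>started u t\<close> says that \<open>t\<close> is in the range where \<^const>\<open>births\<close> is not clamped.\<close>

definition started :: "int option \<Rightarrow> int \<Rightarrow> bool" where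
  "started u t = (case u of None \<Rightarrow> True | Some b \<Rightarrow> b \<le> t)"

section \<open>Comparison of the counts of two functors\<close>

lemma births_le_clamped:
  assumes F: "zfunctor F" and "\<not> started u t"
  shows "births F u s \<le> births F u t"
proof -
  obtain b where b: "u = Some b" "t < b" using assms(2) by (auto simp: started_def split: option.splits)
  have "births F u s = births F u (max b s)" "births F u t = births F u b"
    using b by (simp_all add: births_def)
  thus ?thesis using antimonoD[OF antimono_births[OF F], of b "max b s" u] by simp
qed

lemma deaths_le_clamped:
  assumes F: "zfunctor F" and "\<not> started (flip v) t"
  shows "deaths F v s \<le> deaths F v t"
proof -
  obtain e where e: "v = Some e" "t < 1 - e"
    using assms(2) by (cases v) (auto simp: started_def)
  have "deaths F v s = deaths F v (max (1 - e) s)" "deaths F v t = deaths F v (1 - e)"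
    using e by (simp_all add: deaths_def min_def max_def)
  thus ?thesis using antimonoD[OF antimono_deaths[OF F], of "1 - e" "max (1 - e) s" v] by simp
qed

text \<open>For birth \<open>b\<close>, \<open>h\<close> maps the pair
  \<open>im N (b - 1) s \<subseteq> im N b s\<close> onto the corresponding pair for
  \<open>P\<close>, which does not increase the difference of cardinalities.\<close>

lemma births_le_births:
  assumes P: "zfunctor P" and N: "zfunctor N" and "s \<le> t" "started u s"
    and im: "\<And>a. a \<le> s \<Longrightarrow> im P a t = h ` im N a s"
  shows "births P u t \<le> births N u s"
proof (cases u)
  case None
  obtain a where "a \<le> s" "rk P {..t} = card (im P a t)" "rk N {..s} = card (im N a s)"
    using eventually_happens[OF eventually_conj[OF eventually_le_at_bot[of s]
        eventually_conj[OF eventually_rk_atMost[OF P, of t] eventually_rk_atMost[OF N, of s]]]] by auto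
  thus ?thesis using None im[of a] card_image_le[OF finite_im[OF N]] by (simp add: births_def)
next
  case (Some b)
  hence b: "b \<le> s" using assms(4) by (simp add: started_def)
  have "im N (b - 1) s \<subseteq> im N b s" using b by (intro im_mono[OF N]) auto
  from card_image_exchange[OF finite_im[OF N] this, of h]
  show ?thesis
    using Some b \<open>s \<le> t\<close> im[of b] im[of "b - 1"] by (simp add: births_def rk_atLeastAtMost[OF P] rk_atLeastAtMost[OF N])
qed

text \<open>Dually, an inclusion of images replaces the surjection, and the structure map across the
  death is the map in \<open>card_image_exchange\<close>. The offset between the indices of
  \<open>P\<close> and \<open>N\<close> is \<open>k\<close>.\<close>

lemma deaths_le_deaths:
  fixes P N :: "'a zdiagram"
  assumes P: "zfunctor P" and N: "zfunctor N"
    and "started (flip v) t" "started (flip (map_option (\<lambda>e. e + k) v)) s"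
    and sub: "\<And>d. - t \<le> d \<Longrightarrow> - s \<le> d + k \<Longrightarrow> im P (- t) d \<subseteq> im N (- s) (d + k)"
    and hom: "\<And>d. hom P d (d + 1) = hom N (d + k) (d + k + 1)"
  shows "deaths P v t \<le> deaths N (map_option (\<lambda>e. e + k) v) s"
proof (cases v)
  case None
  obtain d where d: "max (- s) (k - t) \<le> d" "rk N {- s..} = card (im N (- s) d)"
    using eventually_happens[OF eventually_conj[OF eventually_ge_at_top[of "max (- s) (k - t)"]
        eventually_rk_atLeast[OF N, of "- s"]]] by auto
  have "rk P {- t..} \<le> card (im P (- t) (d - k))"
    using rk_atLeast_le[OF P, of "- t" "d - k"] d(1) by (simp add: rk_atLeastAtMost[OF P])
  also have "\<dots> \<le> card (im N (- s) d)"
    using sub[of "d - k"] d(1) by (intro card_mono finite_im[OF N]) simp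
  finally show ?thesis using None d(2) by (simp add: deaths_def)
next
  case (Some e)
  hence e: "- t \<le> e - 1" "- s \<le> e - 1 + k" using assms(3,4) by (auto simp: started_def)
  have "im P (- t) (e - 1) \<subseteq> im N (- s) (e - 1 + k)" using e by (intro sub)
  from card_image_exchange[OF finite_im[OF N] this, of "hom P (e - 1) e"]
  have "card (im N (- s) (e + k)) + card (im P (- t) (e - 1)) \<le>
      card (im N (- s) (e - 1 + k)) + card (im P (- t) e)"
    using hom_image_im[OF P, of "- t" "e - 1" e] hom_image_im[OF N, of "- s" "e - 1 + k" "e + k"] e
      hom[of "e - 1"] by (simp add: algebra_simps)
  thus ?thesis
    using Some e by (simp add: deaths_def rk_atLeastAtMost[OF P] rk_atLeastAtMost[OF N] min_def algebra_simps)
qed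

section \<open>The induced matching of an interleaving\<close>

lemma coord_dist_hi:
  assumes "\<And>t. before t v \<Longrightarrow> before (t - int k) w" "\<And>t. before t w \<Longrightarrow> before (t - int k) v"
  shows "coord_dist (hi v) (hi w) \<le> ereal (real k)"
proof (cases v; cases w)
  fix x y assume vw: "v = Some x" "w = Some y"
  have "\<bar>x - y\<bar> \<le> int k" using assms(1)[of "x - 1"] assms(2)[of "y - 1"] vw by simp
  hence "\<bar>real_of_int x - real_of_int y\<bar> \<le> real k" by linarith
  thus ?thesis using vw by (simp add: coord_dist_def hi_def)
next
  fix x assume "v = Some x" "w = None"
  thus ?thesis using assms(2)[of "x + int k"] by simp
next
  fix y assume "v = None" "w = Some y"
  thus ?thesis using assms(1)[of "y + int k"] by simp
qed (simp add: coord_dist_def hi_def)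

lemma coord_dist_lo:
  assumes "\<And>t. before t (flip u) \<Longrightarrow> before (t - int k) (flip u')"
    "\<And>t. before t (flip u') \<Longrightarrow> before (t - int k) (flip u)"
  shows "coord_dist (lo u) (lo u') \<le> ereal (real k)"
proof -
  have "coord_dist (lo u) (lo u') = coord_dist (hi (flip u)) (hi (flip u'))"
    by (cases u; cases u') (auto simp: coord_dist_def lo_def hi_def)
  thus ?thesis using coord_dist_hi[OF assms] by simp
qed

lemma coord_dist_lo_hi:
  assumes "bar u v \<noteq> {}" "u = Some b" "v = Some e" "e - b \<le> int k"
  shows "coord_dist (lo u) (hi v) \<le> ereal (real k)"
proof -
  have "\<bar>real_of_int b - real_of_int e\<bar> \<le> real k" using assms by auto
  thus ?thesis using assms by (simp add: coord_dist_def lo_def hi_def)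
qed

text \<open>\<open>K\<close> will index the bars of the intermediate functor; the matching is
  \<open>\<psi>\<close> after the inverse of \<open>\<phi>\<close>.\<close>

lemma ex_eps_matchingI:
  assumes inj: "inj_on \<phi> K" "inj_on \<psi> K" and sub: "\<phi> ` K \<subseteq> copies X" "\<psi> ` K \<subseteq> copies Y"
    and dist: "\<And>k. k \<in> K \<Longrightarrow> point_dist (fst (\<phi> k)) (fst (\<psi> k)) \<le> ereal \<epsilon>"
    and X: "\<And>p. p \<in> copies X - \<phi> ` K \<Longrightarrow> coord_dist (fst (fst p)) (snd (fst p)) \<le> ereal (2 * \<epsilon>)"
    and Y: "\<And>p. p \<in> copies Y - \<psi> ` K \<Longrightarrow> coord_dist (fst (fst p)) (snd (fst p)) \<le> ereal (2 * \<epsilon>)"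
  shows "\<exists>\<alpha>. eps_matching \<epsilon> X Y \<alpha>"
proof
  let ?\<alpha> = "\<lambda>p. if p \<in> \<phi> ` K then Some (\<psi> (inv_into K \<phi> p)) else None"
  define \<alpha> where "\<alpha> = ?\<alpha>"
  have \<alpha>: "\<alpha> p = Some q \<longleftrightarrow> (\<exists>k\<in>K. p = \<phi> k \<and> q = \<psi> k)" for p q
    using inj(1) by (auto simp: \<alpha>_def)
  have dom: "dom \<alpha> = \<phi> ` K" by (rule set_eqI) (simp add: \<alpha>_def domIff del: not_None_eq)
  have ran: "ran \<alpha> = \<psi> ` K" unfolding ran_def \<alpha> by blast
  have "inj_on \<alpha> (dom \<alpha>)"
  proof (rule inj_onI)
    fix p q assume "p \<in> dom \<alpha>" "q \<in> dom \<alpha>" and eq: "\<alpha> p = \<alpha> q"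
    then obtain r where "\<alpha> p = Some r" "\<alpha> q = Some r" by (auto simp: dom_def)
    thus "p = q" using \<alpha> inj(2) by (metis inj_onD)
  qed
  moreover have "coord_dist (fst u) (snd u) \<le> ereal (2 * \<epsilon>)"
    if "(u, i) \<in> (copies X - dom \<alpha>) \<union> (copies Y - ran \<alpha>)" for u i
    using that X[of "(u, i)"] Y[of "(u, i)"] by (auto simp: dom ran)
  moreover have "point_dist (fst p) (fst q) \<le> ereal \<epsilon>" if "\<alpha> p = Some q" for p q
    using that dist by (auto simp only: \<alpha>)
  ultimately have "eps_matching \<epsilon> X Y \<alpha>"
    using sub unfolding eps_matching_def dom ran by fast
  thus "eps_matching \<epsilon> X Y ?\<alpha>" unfolding \<alpha>_def .
qed

section \<open>The image functor of an interleaving morphism\<close>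

locale interleaving =
  fixes F :: "'a zdiagram" and G :: "'b zdiagram" and f :: "int \<Rightarrow> 'a \<Rightarrow> 'b" and g :: "int \<Rightarrow> 'b \<Rightarrow> 'a"
    and e :: nat
  assumes F: "zfunctor F" and G: "zfunctor G"
    and f: "nat_trans F (zshift e G) f" and g: "nat_trans G (zshift e F) g"
    and gf: "\<And>a x. x \<in> ob F a \<Longrightarrow> g (a + int e) (f a x) = hom F a (a + 2 * int e) x"
    and fg: "\<And>a y. y \<in> ob G a \<Longrightarrow> f (a + int e) (g a y) = hom G a (a + 2 * int e) y"
begin

lemma f_ob: "x \<in> ob F a \<Longrightarrow> f a x \<in> ob G (a + int e)"
  and f_hom: "a \<le> b \<Longrightarrow> x \<in> ob F a \<Longrightarrow> f b (hom F a b x) = hom G (a + int e) (b + int e) (f a x)"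
  and g_ob: "y \<in> ob G a \<Longrightarrow> g a y \<in> ob F (a + int e)"
  and g_hom: "a \<le> b \<Longrightarrow> y \<in> ob G a \<Longrightarrow> g b (hom G a b y) = hom F (a + int e) (b + int e) (g a y)"
  using f g by (auto simp: nat_trans_def zshift_def)

definition Q :: "'b zdiagram" where
  "Q = \<lparr>ob = (\<lambda>a. f a ` ob F a), hom = (\<lambda>a b. hom G (a + int e) (b + int e))\<rparr>"

lemma zfunctor_Q: "zfunctor Q"
  unfolding zfunctor_def Q_def
  using zfunctorD[OF F] zfunctorD[OF G] f_ob by (auto simp: f_hom[symmetric])

lemma im_Q: "a \<le> b \<Longrightarrow> im Q a b = f b ` im F a b"
  by (auto simp: im_def Q_def image_image f_hom)

lemma im_Q_subset: "a \<le> b \<Longrightarrow> im Q a b \<subseteq> im G (a + int e) (b + int e)"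
  using f_ob by (auto simp: im_def Q_def)

text \<open>The structure map of \<open>F\<close> over \<open>2 * int e\<close> is \<open>g\<close>
  after \<open>f\<close>, hence factors through \<open>Q\<close>.\<close>

lemma im_F_eq:
  assumes "a \<le> b"
  shows "im F a (b + 2 * int e) = g (b + int e) ` im Q a b"
proof -
  have "g (b + int e) (f b (hom F a b x)) = hom F a (b + 2 * int e) x" if "x \<in> ob F a" for x
    using gf[of "hom F a b x" b] that assms zfunctorD(2)[OF F, of a b x]
      zfunctorD(4)[OF F, of a b "b + 2 * int e" x] by simp
  thus ?thesis by (simp add: im_Q[OF assms] im_def[of F] image_image)
qed

text \<open>By \<open>fg\<close>, what comes from \<open>a - int e\<close> in \<open>G\<close> is
  already a value of \<open>f a\<close> at index \<open>a + int e\<close>.\<close>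

lemma im_G_subset:
  assumes "a \<le> b"
  shows "im G (a - int e) (b + int e) \<subseteq> im Q a b"
proof
  fix z assume "z \<in> im G (a - int e) (b + int e)"
  then obtain y where y: "y \<in> ob G (a - int e)" "z = hom G (a - int e) (b + int e) y" by (auto simp: im_def)
  have gy: "g (a - int e) y \<in> ob F a" using g_ob[OF y(1)] by simp
  have "f a (g (a - int e) y) = hom G (a - int e) (a + int e) y"
    using fg[OF y(1)] by (simp add: algebra_simps)
  hence "z = hom G (a + int e) (b + int e) (f a (g (a - int e) y))"
    using zfunctorD(4)[OF G, of "a - int e" "a + int e" "b + int e" y] y assms by simp
  thus "z \<in> im Q a b" using gy by (auto simp: im_def Q_def)
qed

lemma births_Q_F:
  "\<exists>w i. i < mult (births F u) w \<and> base (births F u) w + i = base (births Q u) v + j \<and>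
    (\<forall>t. before t v \<longrightarrow> before t w) \<and> (\<forall>t. before t w \<longrightarrow> before (t - 2 * int e) v)"
  if j: "j < mult (births Q u) v"
proof -
  have le: "births Q u t \<le> births F u t" if "started u t" for t
    using that by (intro births_le_births[OF zfunctor_Q F, where h = "f t"]) (simp_all add: im_Q)
  have QF: "births Q u t \<le> births F u (t - 0)" for t
  proof (cases "started u t")
    case False
    then obtain b where "u = Some b" "t < b" by (auto simp: started_def split: option.splits)
    thus ?thesis using le[of b] by (simp add: births_def started_def)
  qed (use le in simp)
  have "births F u t \<le> births Q u (t - 2 * int e) \<or>
      (\<forall>s. births Q u s \<le> births Q u (t - 2 * int e))" for t
  proof (cases "started u (t - 2 * int e)")
    case True
    have "births F u t \<le> births Q u (t - 2 * int e)"
      using im_F_eq[of _ "t - 2 * int e"] True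
      by (intro births_le_births[OF F zfunctor_Q, where h = "g (t - int e)"]) (simp_all add: algebra_simps)
    thus ?thesis ..
  qed (use births_le_clamped[OF zfunctor_Q] in blast)
  from slot_transfer[OF antimono_births[OF zfunctor_Q] antimono_births[OF F] QF this j]
  show ?thesis by simp
qed

text \<open>Were the bar alive \<open>2 * int e\<close> after a started time, the count of
  \<open>F\<close> there would be at most that of \<open>Q\<close> at the started time, and
  \<open>slot_reached\<close> would produce a partner.\<close>

lemma unmatched_F:
  assumes p: "0 < dgm_points F (pt u w)" "i < mult (births F u) w"
    and unmatched: "\<And>v j. j < mult (births Q u) v \<Longrightarrow> base (births Q u) v + j \<noteq> base (births F u) w + i"
  shows "coord_dist (lo u) (hi w) \<le> ereal (real (2 * e))"
proof -
  have "bar u w \<noteq> {}" using p(1) by (auto simp: dgm_points_pt split: if_splits)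
  have late: "\<not> before (t + 2 * int e) w" if "started u t" for t
  proof
    assume *: "before (t + 2 * int e) w"
    have "births F u (t + 2 * int e) \<le> births Q u t"
      using that by (intro births_le_births[OF F zfunctor_Q, where h = "g (t + int e)"]) (simp_all add: im_F_eq)
    thus False
      using slot_reached[OF antimono_births[OF zfunctor_Q] antimono_births[OF F] p(2) *] unmatched by blast
  qed
  obtain y where w: "w = Some y"
    using late[of "case u of None \<Rightarrow> 0 | Some b \<Rightarrow> b"] by (cases w; cases u) (auto simp: started_def)
  \<comment> \<open>With infinite birth every time is started, also the one \<open>2 * int e\<close>
    before the last time \<open>y - 1\<close> of the bar.\<close>
  obtain b where u: "u = Some b"
    using late[of "y - 1 - 2 * int e"] w by (cases u) (auto simp: started_def)
  have "y - b \<le> int (2 * e)" using late[of b] u w by (simp add: started_def)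
  thus ?thesis using coord_dist_lo_hi[OF \<open>bar u w \<noteq> {}\<close> u w, of "2 * e"] by simp
qed

text \<open>\<open>Q\<close> at index \<open>a\<close> lies in \<open>G\<close> at
  \<open>a + int e\<close>, so a death in \<open>Q\<close> corresponds to one in \<open>G\<close>
  that is later by \<open>e\<close>.\<close>

abbreviation shift :: "int option \<Rightarrow> int option" where
  "shift \<equiv> map_option (\<lambda>x. x + int e)"

lemma deaths_G_le:
  assumes "started (flip v) (t - int e)"
  shows "deaths G (shift v) t \<le> deaths Q v (t - int e)"
proof -
  \<comment> \<open>The comparison runs from \<open>G\<close> to \<open>Q\<close> with offset
    \<open>- int e\<close>, so \<open>v\<close> is written as a shift of
    \<open>shift v\<close>.\<close>
  have v: "map_option (\<lambda>x. x + - int e) (shift v) = v" by (cases v) simp_all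
  have st: "started (flip (shift v)) t"
    using assms by (cases v) (auto simp: started_def)
  have "deaths G (shift v) t \<le> deaths Q (map_option (\<lambda>x. x + - int e) (shift v)) (t - int e)"
  proof (rule deaths_le_deaths[OF G zfunctor_Q])
    show "started (flip (shift v)) t" by fact
    show "started (flip (map_option (\<lambda>x. x + - int e) (shift v))) (t - int e)" using assms unfolding v .
    show "im G (- t) d \<subseteq> im Q (- (t - int e)) (d + - int e)"
      if "- t \<le> d" "- (t - int e) \<le> d + - int e" for d
      using im_G_subset[of "- (t - int e)" "d + - int e"] that by simp
    show "hom G d (d + 1) = hom Q (d + - int e) (d + - int e + 1)" for d
      by (simp add: Q_def algebra_simps)
  qed
  thus ?thesis unfolding v .
qed

lemma deaths_Q_G:
  "\<exists>w i. i < mult (deaths G (shift v)) w \<and> base (deaths G (shift v)) w + i = base (deaths Q v) r + j \<and>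
    (\<forall>t. before t r \<longrightarrow> before (t - int e) w) \<and> (\<forall>t. before t w \<longrightarrow> before (t - int e) r)"
  if j: "j < mult (deaths Q v) r"
proof -
  have le: "deaths Q v t \<le> deaths G (shift v) (t - int e)" if st: "started (flip v) t" for t
  proof (rule deaths_le_deaths[OF zfunctor_Q G])
    show "started (flip v) t" by fact
    show "started (flip (shift v)) (t - int e)" using st by (cases v) (auto simp: started_def)
    show "im Q (- t) d \<subseteq> im G (- (t - int e)) (d + int e)" if "- t \<le> d" for d
      using im_Q_subset[OF that] by (simp add: algebra_simps)
    show "hom Q d (d + 1) = hom G (d + int e) (d + int e + 1)" for d
      by (simp add: Q_def algebra_simps)
  qed
  have QG: "deaths Q v t \<le> deaths G (shift v) (t - int e)" for t
  proof (cases "started (flip v) t")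
    case False
    then obtain x where "v = Some x" "t < 1 - x" by (cases v) (auto simp: started_def)
    thus ?thesis using le[of "1 - x"] by (simp add: deaths_def started_def min_def algebra_simps)
  qed (rule le)
  have "deaths G (shift v) t \<le> deaths Q v (t - int e) \<or>
      (\<forall>s. deaths Q v s \<le> deaths Q v (t - int e))" for t
    using deaths_G_le deaths_le_clamped[OF zfunctor_Q] by blast
  from slot_transfer[OF antimono_deaths[OF zfunctor_Q] antimono_deaths[OF G] QG this j]
  show ?thesis .
qed

lemma unmatched_G:
  assumes p: "0 < dgm_points G (pt u (shift v))" "i < mult (deaths G (shift v)) (flip u)"
    and unmatched: "\<And>r j. j < mult (deaths Q v) r \<Longrightarrow>
      base (deaths Q v) r + j \<noteq> base (deaths G (shift v)) (flip u) + i"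
  shows "coord_dist (lo u) (hi (shift v)) \<le> ereal (real (2 * e))"
proof -
  have "bar u (shift v) \<noteq> {}" using p(1) by (auto simp: dgm_points_pt split: if_splits)
  have late: "\<not> before t (flip u)" if "started (flip v) (t - int e)" for t
    using slot_reached[OF antimono_deaths[OF zfunctor_Q] antimono_deaths[OF G] p(2), where t = t and s = "t - int e"]
      deaths_G_le[OF that] unmatched by blast
  obtain b where u: "u = Some b"
    using late[of "int e + (case flip v of None \<Rightarrow> 0 | Some b \<Rightarrow> b)"]
    by (cases u; cases v) (auto simp: started_def)
  obtain y where v: "v = Some y"
    using late[of "- b"] u by (cases v) (auto simp: started_def)
  \<comment> \<open>\<open>1 - y\<close> is the first unclamped reflected time of \<open>Q\<close>,
    so the reflected birth \<open>1 - b\<close> is at most \<open>1 - y + int e\<close>.\<close>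
  have "(y + int e) - b \<le> int (2 * e)" using late[of "1 - y + int e"] u v by (simp add: started_def)
  thus ?thesis using coord_dist_lo_hi[OF \<open>bar u (shift v) \<noteq> {}\<close> u, of "y + int e" "2 * e"] v by simp
qed

lemma ex_matching: "\<exists>\<alpha>. eps_matching (real e) (dgm_points F) (dgm_points G) \<alpha>"
proof -
  \<comment> \<open>The multiplicity of \<open>pt u v\<close> is that of slot \<open>v\<close> in
    birth class \<open>u\<close> and of slot \<open>flip u\<close> in death class \<open>v\<close>,
    so one triple indexes a bar of \<open>Q\<close> in both classes.\<close>
  define K where "K = {(u, v, j). j < dgm_points Q (pt u v)}"
  have "\<forall>u v j. \<exists>w i. j < mult (births Q u) v \<longrightarrow>
      i < mult (births F u) w \<and> base (births F u) w + i = base (births Q u) v + j \<and>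
      (\<forall>t. before t v \<longrightarrow> before t w) \<and> (\<forall>t. before t w \<longrightarrow> before (t - 2 * int e) v)"
    using births_Q_F by blast
  then obtain W I where WI: "\<And>u v j. j < mult (births Q u) v \<Longrightarrow>
      I u v j < mult (births F u) (W u v j) \<and>
      base (births F u) (W u v j) + I u v j = base (births Q u) v + j \<and>
      (\<forall>t. before t v \<longrightarrow> before t (W u v j)) \<and>
      (\<forall>t. before t (W u v j) \<longrightarrow> before (t - 2 * int e) v)"
    by metis
  have "\<forall>r v j. \<exists>w i. j < mult (deaths Q v) r \<longrightarrow>
      i < mult (deaths G (shift v)) w \<and> base (deaths G (shift v)) w + i = base (deaths Q v) r + j \<and>
      (\<forall>t. before t r \<longrightarrow> before (t - int e) w) \<and> (\<forall>t. before t w \<longrightarrow> before (t - int e) r)"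
    using deaths_Q_G by blast
  then obtain R J where RJ: "\<And>r v j. j < mult (deaths Q v) r \<Longrightarrow>
      J r v j < mult (deaths G (shift v)) (R r v j) \<and>
      base (deaths G (shift v)) (R r v j) + J r v j = base (deaths Q v) r + j \<and>
      (\<forall>t. before t r \<longrightarrow> before (t - int e) (R r v j)) \<and>
      (\<forall>t. before t (R r v j) \<longrightarrow> before (t - int e) r)"
    by metis
  define \<phi> where "\<phi> = (\<lambda>(u, v, j). (pt u (W u v j), I u v j))"
  define \<psi> where "\<psi> = (\<lambda>(u, v, j). (pt (flip (R (flip u) v j)) (shift v), J (flip u) v j))"
  have KB: "j < mult (births Q u) v" and KD: "j < mult (deaths Q v) (flip u)"
    if "(u, v, j) \<in> K" for u v j
    using that dgm_points_births[OF zfunctor_Q, of u v] dgm_points_deaths[OF zfunctor_Q, of u v]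
    by (simp_all add: K_def)
  show ?thesis
  proof (rule ex_eps_matchingI)
    show "inj_on \<phi> K"
    proof (rule inj_onI, unfold split_paired_all)
      fix u v j u' v' j'
      assume k: "(u, v, j) \<in> K" "(u', v', j') \<in> K" "\<phi> (u, v, j) = \<phi> (u', v', j')"
      hence "u' = u" "W u v j = W u v' j'" "I u v j = I u v' j'" by (auto simp: \<phi>_def)
      thus "(u, v, j) = (u', v', j')"
        using slot_unique[OF antimono_births[OF zfunctor_Q] KB[OF k(1)], of j' v'] KB[OF k(2)]
          WI[OF KB[OF k(1)]] WI[OF KB[OF k(2)]] by simp
    qed
    show "inj_on \<psi> K"
    proof (rule inj_onI, unfold split_paired_all)
      fix u v j u' v' j'
      assume k: "(u, v, j) \<in> K" "(u', v', j') \<in> K" "\<psi> (u, v, j) = \<psi> (u', v', j')"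
      have "inj shift" by (intro option.inj_map injI) simp
      hence v: "v' = v" using k(3) by (auto simp: \<psi>_def dest: injD)
      have "R (flip u) v j = R (flip u') v j'" "J (flip u) v j = J (flip u') v j'"
        using k(3) v by (auto simp: \<psi>_def)
      hence "flip u = flip u' \<and> j = j'"
        using slot_unique[OF antimono_deaths[OF zfunctor_Q] KD[OF k(1)], of j' "flip u'"] KD[OF k(2)]
          RJ[OF KD[OF k(1)]] RJ[OF KD[OF k(2)]] v by simp
      thus "(u, v, j) = (u', v', j')" using v by simp
    qed
    show "\<phi> ` K \<subseteq> copies (dgm_points F)"
      using WI KB dgm_points_births[OF F] by (force simp: \<phi>_def copies_def)
    show "\<psi> ` K \<subseteq> copies (dgm_points G)"
      using RJ KD dgm_points_deaths[OF G] by (force simp: \<psi>_def copies_def)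
  next
    fix k assume "k \<in> K"
    then obtain u v j where k: "k = (u, v, j)" "(u, v, j) \<in> K" by (cases k) auto
    note W = WI[OF KB[OF k(2)]] and R = RJ[OF KD[OF k(2)]]
    have shift: "before t (shift v) \<longleftrightarrow> before (t - int e) v" for t by (cases v) auto
    \<comment> \<open>\<open>W u v j\<close> lies between \<open>v\<close> and \<open>v\<close>
      delayed by \<open>2 * e\<close>; \<open>shift v\<close> is the midpoint, which halves the
      distance to \<open>e\<close>.\<close>
    have "coord_dist (hi (W u v j)) (hi (shift v)) \<le> ereal (real e)"
    proof (rule coord_dist_hi)
      fix t
      assume "before t (W u v j)"
      hence "before (t - 2 * int e) v" using W by blast
      thus "before (t - int e) (shift v)" by (simp add: shift algebra_simps)
    next
      fix t
      assume "before t (shift v)"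
      thus "before (t - int e) (W u v j)" using W by (simp add: shift)
    qed
    moreover have "coord_dist (lo u) (lo (flip (R (flip u) v j))) \<le> ereal (real e)"
      using R by (intro coord_dist_lo) auto
    ultimately show "point_dist (fst (\<phi> k)) (fst (\<psi> k)) \<le> ereal (real e)"
      by (simp add: point_dist_def \<phi>_def \<psi>_def k(1) pt_def)
  next
    fix p assume p: "p \<in> copies (dgm_points F) - \<phi> ` K"
    obtain q i where pq: "p = (q, i)" by (cases p)
    hence i: "i < dgm_points F q" using p by (auto simp: copies_def)
    hence "0 < dgm_points F q" by simp
    then obtain u w where q: "q = pt u w" using dgm_points_pos by metis
    have iw: "i < mult (births F u) w" using i q dgm_points_births[OF F] by simp
    have "coord_dist (lo u) (hi w) \<le> ereal (real (2 * e))"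
    proof (rule unmatched_F[OF _ iw])
      show "0 < dgm_points F (pt u w)" using i q by simp
      fix v j assume j: "j < mult (births Q u) v"
      show "base (births Q u) v + j \<noteq> base (births F u) w + i"
      proof
        assume "base (births Q u) v + j = base (births F u) w + i"
        \<comment> \<open>Equal numbers within one class force equal slots, so \<open>p\<close>
          would lie in the image of \<open>\<phi>\<close>.\<close>
        hence "W u v j = w \<and> I u v j = i"
          using WI[OF j] iw by (intro slot_unique[OF antimono_births[OF F]]) auto
        hence "\<phi> (u, v, j) = p" by (simp add: \<phi>_def pq q)
        moreover have "(u, v, j) \<in> K" using j dgm_points_births[OF zfunctor_Q] by (simp add: K_def)
        ultimately show False using p by blast
      qed
    qed
    thus "coord_dist (fst (fst p)) (snd (fst p)) \<le> ereal (2 * real e)" by (simp add: pq q pt_def)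
  next
    fix p assume p: "p \<in> copies (dgm_points G) - \<psi> ` K"
    obtain q i where pq: "p = (q, i)" by (cases p)
    hence i: "i < dgm_points G q" using p by (auto simp: copies_def)
    hence "0 < dgm_points G q" by simp
    then obtain u v' where q: "q = pt u v'" using dgm_points_pos by metis
    obtain v where v: "v' = shift v"
    proof
      show "v' = shift (map_option (\<lambda>x. x - int e) v')" by (cases v') simp_all
    qed
    have iw: "i < mult (deaths G (shift v)) (flip u)" using i q v dgm_points_deaths[OF G] by simp
    have "coord_dist (lo u) (hi (shift v)) \<le> ereal (real (2 * e))"
    proof (rule unmatched_G[OF _ iw])
      show "0 < dgm_points G (pt u (shift v))" using i q v by simp
      fix r j assume j: "j < mult (deaths Q v) r"
      show "base (deaths Q v) r + j \<noteq> base (deaths G (shift v)) (flip u) + i"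
      proof
        assume "base (deaths Q v) r + j = base (deaths G (shift v)) (flip u) + i"
        hence "R r v j = flip u \<and> J r v j = i"
          using RJ[OF j] iw by (intro slot_unique[OF antimono_deaths[OF G]]) auto
        hence "\<psi> (flip r, v, j) = p" by (simp add: \<psi>_def pq q v)
        moreover have "(flip r, v, j) \<in> K" using j dgm_points_deaths[OF zfunctor_Q] by (simp add: K_def)
        ultimately show False using p by blast
      qed
    qed
    thus "coord_dist (fst (fst p)) (snd (fst p)) \<le> ereal (2 * real e)" by (simp add: pq q v pt_def)
  qed
qed

end

theorem corollary4p16:
  fixes F :: "'a zdiagram" and G :: "'b zdiagram"
  assumes "zfunctor F" and "zfunctor G"
  shows "d_B (dgm_points F) (dgm_points G) \<le> d_I F G"
  unfolding d_I_def
proof (rule Inf_greatest)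
  fix x assume "x \<in> {ereal (real e) |e. interleaved e F G}"
  then obtain e where x: "x = ereal (real e)" and "interleaved e F G" by blast
  then obtain f g where "interleaving F G f g e"
    using assms unfolding interleaved_def interleaving_def by blast
  then obtain \<alpha> where "eps_matching (real e) (dgm_points F) (dgm_points G) \<alpha>"
    using interleaving.ex_matching by blast
  thus "d_B (dgm_points F) (dgm_points G) \<le> x"
    unfolding d_B_def x by (intro Inf_lower) auto
qed

end
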